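(* Any non-trivial reptiling of an oblique triangle $T$ has at least one hanging vertex, i.e. a point in the interior of $T$ that is a corner of some tile and lies in the relative interior of a side of another tile.
   Context: An $r$-reptiling of a triangle $T$ ($r \ge 2$) is a subdivision of $T$ into $r$ triangles (tiles) with pairwise disjoint interiors, each similar to $T$ and all mutually congruent; necessarily $r=n^2$. The trivial $n^2$-reptiling of $T$ is obtained by dividing every side of $T$ into $n$ equal segments and drawing all lines parallel to the sides of $T$ through the endpoints of these segments; a reptiling is non-trivial if it is not this subdivision. A triangle is oblique if it is not a right triangle. *)

theory Defs
  imports "HOL-Analysis.Analysis"
begin

abbreviation triangle :: "(real^2) set \<Rightarrow> bool"
  where "triangle T \<equiv> 2 simplex T"

definition corners :: "(real^2) set \<Rightarrow> (real^2) set"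
  where "corners T = {x. x extreme_point_of T}"

definition right_triangle :: "(real^2) set \<Rightarrow> bool"
  where "right_triangle T \<longleftrightarrow> triangle T \<and>
    (\<exists>a b c. corners T = {a, b, c} \<and> orthogonal (b - a) (c - a))"

definition oblique_triangle :: "(real^2) set \<Rightarrow> bool"
  where "oblique_triangle T \<longleftrightarrow> triangle T \<and> \<not> right_triangle T"

text \<open>As usual for plane figures, reflections are allowed in congruences and similarities.\<close>

definition similar_sets :: "(real^2) set \<Rightarrow> (real^2) set \<Rightarrow> bool"
  where "similar_sets S S' \<longleftrightarrow>
    (\<exists>f k. k > 0 \<and> (\<forall>x y. dist (f x) (f y) = k * dist x y) \<and> f ` S = S')"

definition congruent_sets :: "(real^2) set \<Rightarrow> (real^2) set \<Rightarrow> bool"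
  where "congruent_sets S S' \<longleftrightarrow>
    (\<exists>f. (\<forall>x y. dist (f x) (f y) = dist x y) \<and> f ` S = S')"

definition reptiling :: "nat \<Rightarrow> (real^2) set \<Rightarrow> (real^2) set set \<Rightarrow> bool"
  where "reptiling r T P \<longleftrightarrow> r \<ge> 2 \<and> triangle T \<and> finite P \<and> card P = r \<and>
    (\<forall>t\<in>P. triangle t \<and> similar_sets T t) \<and>
    (\<forall>s\<in>P. \<forall>t\<in>P. congruent_sets s t) \<and>
    pairwise (\<lambda>s t. interior s \<inter> interior t = {}) P \<and>
    \<Union>P = T"

definition division_points :: "nat \<Rightarrow> (real^2) set \<Rightarrow> (real^2) set"
  where "division_points n T =
    {a + (real i / real n) *\<^sub>R (b - a) | a b i.
      a \<in> corners T \<and> b \<in> corners T \<and> a \<noteq> b \<and> i \<le> n}"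

definition grid_lines :: "nat \<Rightarrow> (real^2) set \<Rightarrow> (real^2) set set"
  where "grid_lines n T =
    {range (\<lambda>s. p + s *\<^sub>R (b - a)) | p a b.
      p \<in> division_points n T \<and> a \<in> corners T \<and> b \<in> corners T \<and> a \<noteq> b}"

text \<open>The lines through the division points include the lines carrying the sides of \<open>T\<close>, so
  the set whose components are taken below is open.\<close>

definition trivial_reptiling :: "nat \<Rightarrow> (real^2) set \<Rightarrow> (real^2) set set"
  where "trivial_reptiling n T = closure ` components (T - \<Union>(grid_lines n T))"

text \<open>The number of tiles of \<open>trivial_reptiling n T\<close> is \<open>n\<^sup>2\<close>, so only the \<open>n\<close> with
  \<open>n\<^sup>2 = card P\<close> matters here.\<close>

definition nontrivial_reptiling :: "nat \<Rightarrow> (real^2) set \<Rightarrow> (real^2) set set \<Rightarrow> bool"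
  where "nontrivial_reptiling r T P \<longleftrightarrow>
    reptiling r T P \<and> \<not> (\<exists>n\<ge>1. P = trivial_reptiling n T)"

definition hanging_vertex :: "(real^2) set \<Rightarrow> (real^2) set set \<Rightarrow> real^2 \<Rightarrow> bool"
  where "hanging_vertex T P x \<longleftrightarrow> x \<in> interior T \<and>
    (\<exists>t\<in>P. \<exists>t'\<in>P. t \<noteq> t' \<and> x \<in> corners t \<and> (\<exists>e. e edge_of t' \<and> x \<in> rel_interior e))"

end

theory Submission
  imports Defs
begin

text \<open>Without hanging vertices the tiles meet edge to edge, so across an inner edge \<open>pq\<close> of the tile
  \<open>pqx\<close> lies a tile \<open>pqz\<close>, and by congruence either \<open>z = p + q - x\<close> or \<open>z\<close> is the mirror image of
  \<open>x\<close> in the line \<open>pq\<close>. Let \<open>A\<close> be the corner of \<open>T\<close> with the smallest angle. A single tile fills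
  it; start there and walk along the side of \<open>T\<close> to which that tile contributes its middle side. The
  tile already placed has its largest angle at the next boundary point. A mirror image in place of a
  parallelogram partner would then leave an angle smaller than every tile angle, or cross the side;
  it would fit exactly only if the largest angle were right. So the strip along this side is that of
  the trivial reptiling, which also forces the ratio of \<open>T\<close> to the tile to be an integer. Removing
  the strip leaves a smaller triangle similar to \<open>T\<close>, and induction applies.\<close>

section \<open>Triangles in the plane\<close>

text \<open>A mirror image cannot be refuted at an inner edge alone, where it fits as well as the
  parallelogram partner. What refutes it is the straight angle available at a boundary point, so the
  walk stays on the boundary. It needs the largest tile angle at the next boundary point: with the
  middle angle there, mirror images may fit, as three angles of 60 degrees do. It is not known
  beforehand which way round the corner tile lies: its middle side may run along the longest side of
  \<open>T\<close>. The strip argument uses only the tile's own sides and works in both positions.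
  Comparing the finished strip with \<open>T\<close> then excludes the reversed position, unless the
  two longer sides are equal and the positions do not differ in shape. No angles are computed. In
  oblique coordinates with the corner tile as unit, an angle that does not fit shows as a negative
  coordinate of a tile vertex.\<close>

definition cross :: "real^2 \<Rightarrow> real^2 \<Rightarrow> real"
  where "cross x y = x $ 1 * y $ 2 - x $ 2 * y $ 1"

lemma inner_real2: "x \<bullet> y = x $ 1 * y $ 1 + x $ 2 * y $ 2" for x y :: "real^2"
  by (simp add: inner_vec_def sum_2)

lemma cross_simps [simp]:
  "cross (x + y) z = cross x z + cross y z" "cross z (x + y) = cross z x + cross z y"
  "cross (x - y) z = cross x z - cross y z" "cross z (x - y) = cross z x - cross z y"
  "cross (r *\<^sub>R x) z = r * cross x z" "cross z (r *\<^sub>R x) = r * cross z x"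
  "cross (- x) z = - cross x z" "cross z (- x) = - cross z x"
  "cross x x = 0" "cross 0 x = 0" "cross x 0 = 0"
  by (simp_all add: cross_def algebra_simps)

lemma cross_commute: "cross x y = - cross y x"
  by (simp add: cross_def)

lemma cross_lagrange: "(cross x y)\<^sup>2 + (x \<bullet> y)\<^sup>2 = (x \<bullet> x) * (y \<bullet> y)"
  by (simp add: cross_def inner_real2 power2_eq_square algebra_simps)

lemma real2_eqI:
  assumes "cross u w \<noteq> 0" "cross u x = cross u y" "cross x w = cross y w"
  shows "x = y"
proof -
  have "cross u w * x $ 1 = cross u w * y $ 1" "cross u w * x $ 2 = cross u w * y $ 2"
    using assms(2,3) unfolding cross_def by algebra+
  then show ?thesis using assms(1) by (simp add: vec_eq_iff forall_2)
qed

text \<open>Cramer's rule; it gives every point coordinates in an oblique frame.\<close>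

lemma cross_coordinates:
  assumes "cross u w \<noteq> 0"
  shows "x = (cross x w / cross u w) *\<^sub>R u + (cross u x / cross u w) *\<^sub>R w"
  by (rule real2_eqI[OF assms]) (use assms in auto)

text \<open>Collinearity is equality in the Cauchy-Schwarz inequality, and
  \<open>cross_lagrange\<close> gives the defect there as the square of the determinant.\<close>

lemma collinear_iff_cross: "collinear {p, q, r} \<longleftrightarrow> cross (q - p) (r - p) = 0"
proof -
  have "collinear {p, q, r} \<longleftrightarrow> collinear {0, q - p, r - p}"
    using collinear_3[of q p r] by (simp add: insert_commute)
  also have "\<dots> \<longleftrightarrow> \<bar>(q - p) \<bullet> (r - p)\<bar> = norm (q - p) * norm (r - p)"
    by (simp add: norm_cauchy_schwarz_equal)
  also have "\<dots> \<longleftrightarrow> ((q - p) \<bullet> (r - p))\<^sup>2 = (norm (q - p) * norm (r - p))\<^sup>2"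
    by (metis abs_ge_zero abs_norm_cancel abs_mult power2_abs power2_eq_iff_nonneg)
  also have "\<dots> \<longleftrightarrow> (cross (q - p) (r - p))\<^sup>2 = 0"
    using cross_lagrange[of "q - p" "r - p"]
    by (auto simp: power_mult_distrib power2_norm_eq_inner)
  finally show ?thesis by simp
qed

lemma noncollinear_distinct:
  "\<not> collinear {p, q, r} \<Longrightarrow> p \<noteq> q \<and> p \<noteq> r \<and> q \<noteq> r"
  by (auto simp: insert_commute)

lemma noncollinear_affine_independent:
  "\<not> collinear {p, q, r} \<Longrightarrow> \<not> affine_dependent {p, q, r}"
  by (simp add: collinear_3_eq_affine_dependent)

lemma corners_hull:
  "\<not> collinear {p, q, r} \<Longrightarrow> corners (convex hull {p, q, r}) = {p, q, r}"
  unfolding corners_def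
  using extreme_point_of_convex_hull_affine_independent[OF noncollinear_affine_independent]
  by blast

lemma edge_hull:
  assumes "\<not> collinear {p, q, r}"
  shows "closed_segment p q edge_of (convex hull {p, q, r})"
proof -
  have "closed_segment p q face_of (convex hull {p, q, r})"
    using face_of_convex_hull_affine_independent[OF noncollinear_affine_independent[OF assms]]
    by (metis insert_mono segment_convex_hull empty_subsetI)
  moreover have "aff_dim (closed_segment p q) = 1"
    using noncollinear_distinct[OF assms] by (simp add: segment_convex_hull aff_dim_2 aff_dim_convex_hull)
  ultimately show ?thesis by (simp add: edge_of_def)
qed

lemma triangle_iff:
  "triangle t \<longleftrightarrow> (\<exists>p q r. \<not> collinear {p, q, r} \<and> t = convex hull {p, q, r})"
proof
  assume "triangle t"
  then obtain C where C: "\<not> affine_dependent C" "card C = 3" "t = convex hull C"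
    unfolding simplex_def by auto
  from C(2) obtain p q r where "C = {p, q, r}" "p \<noteq> q" "p \<noteq> r" "q \<noteq> r"
    by (auto simp: card_3_iff)
  then show "\<exists>p q r. \<not> collinear {p, q, r} \<and> t = convex hull {p, q, r}"
    using C by (metis collinear_3_eq_affine_dependent)
next
  assume "\<exists>p q r. \<not> collinear {p, q, r} \<and> t = convex hull {p, q, r}"
  then obtain p q r where *: "\<not> collinear {p, q, r}" "t = convex hull {p, q, r}" by auto
  then have "card {p, q, r} = 3" using noncollinear_distinct[OF *(1)] by auto
  then show "triangle t"
    unfolding simplex_def using noncollinear_affine_independent[OF *(1)] * 
    by (intro exI[of _ "{p, q, r}"]) auto
qed

lemma interior_hull:
  fixes p q r :: "real^2"
  assumes "\<not> collinear {p, q, r}"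
  shows "interior (convex hull {p, q, r}) =
    {v. \<exists>x y z. 0 < x \<and> 0 < y \<and> 0 < z \<and> x + y + z = 1 \<and> x *\<^sub>R p + y *\<^sub>R q + z *\<^sub>R r = v}"
  by (rule interior_convex_hull_3_minimal[OF assms]) simp

lemma triangle_basic:
  assumes "triangle t"
  shows "compact t" "convex t" "closed t" "interior t \<noteq> {}" "closure (interior t) = t"
proof -
  obtain p q r where *: "\<not> collinear {p, q, r}" "t = convex hull {p, q, r}"
    using assms triangle_iff by auto
  show 1: "compact t" "convex t" "closed t"
    using * by (auto simp: finite_imp_compact_convex_hull compact_imp_closed)
  have "(1/3) *\<^sub>R p + (1/3) *\<^sub>R q + (1/3) *\<^sub>R r \<in> interior t"
    unfolding * interior_hull[OF *(1)] by (rule CollectI, intro exI[of _ "1/3"]) simp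
  then show 2: "interior t \<noteq> {}" by blast
  show "closure (interior t) = t"
    using convex_closure_interior[OF 1(2) 2] 1(3) by simp
qed

text \<open>The two distances determine the inner product of \<open>z - p\<close> with
  \<open>q - p\<close>, hence by \<open>cross_lagrange\<close> the determinant up to sign, and the
  last hypothesis fixes the sign.\<close>

lemma same_side_eqI:
  assumes "dist z p = dist z' p" "dist z q = dist z' q"
    and "cross (q - p) (z - p) * cross (q - p) (z' - p) > 0"
  shows "z = z'"
proof -
  define d where "d = q - p"
  define y where "y = z - p"
  define y' where "y' = z' - p"
  have n: "y \<bullet> y = y' \<bullet> y'" "(y - d) \<bullet> (y - d) = (y' - d) \<bullet> (y' - d)"
    using assms(1,2) by (auto simp: d_def y_def y'_def dist_norm norm_eq)
  then have i: "d \<bullet> y = d \<bullet> y'"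
    by (simp add: algebra_simps inner_commute)
  then have "(cross d y)\<^sup>2 = (cross d y')\<^sup>2"
    using cross_lagrange[of d y] cross_lagrange[of d y'] n(1) by simp
  moreover have s: "cross d y * cross d y' > 0" using assms(3) by (simp add: d_def y_def y'_def)
  ultimately have c: "cross d y = cross d y'"
    by (metis mult_minus_right not_square_less_zero power2_eq_iff neg_0_less_iff_less mult_minus_left)
  have "d \<bullet> d \<noteq> 0" using s by auto
  moreover have "(d \<bullet> d) * y $ 1 = (d \<bullet> d) * y' $ 1" "(d \<bullet> d) * y $ 2 = (d \<bullet> d) * y' $ 2"
    using i c unfolding cross_def inner_real2 by algebra+
  ultimately have "y $ 1 = y' $ 1" "y $ 2 = y' $ 2" by simp_all
  then have "y = y'" by (simp add: vec_eq_iff forall_2)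
  then show ?thesis by (simp add: y_def y'_def)
qed

section \<open>Mirror images and the two candidates for a neighbour\<close>

definition mirror :: "real^2 \<Rightarrow> real^2 \<Rightarrow> real^2"
  where "mirror d x = (2 * (x \<bullet> d) / (d \<bullet> d)) *\<^sub>R d - x"

lemma mirror_props:
  assumes "d \<noteq> 0"
  shows "norm (mirror d x) = norm x" "norm (mirror d x - d) = norm (x - d)"
    "cross d (mirror d x) = - cross d x"
proof -
  have d: "d \<bullet> d \<noteq> 0" using assms by simp
  have a: "mirror d x \<bullet> mirror d x = x \<bullet> x"
    using d by (simp add: mirror_def inner_diff_left inner_diff_right field_simps inner_commute)
  then show "norm (mirror d x) = norm x" by (simp add: norm_eq)
  have b: "mirror d x \<bullet> d = x \<bullet> d"
    using d by (simp add: mirror_def inner_diff_left inner_diff_right field_simps inner_commute)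
  have "(mirror d x - d) \<bullet> (mirror d x - d) = (x - d) \<bullet> (x - d)"
    using a b by (simp add: inner_diff_left inner_diff_right inner_commute)
  then show "norm (mirror d x - d) = norm (x - d)" by (simp add: norm_eq)
  show "cross d (mirror d x) = - cross d x" by (simp add: mirror_def)
qed

text \<open>The remaining two sides can be matched in two ways, and \<open>same_side_eqI\<close>
  turns each into one point. If \<open>x\<close> is equidistant from \<open>p\<close> and
  \<open>q\<close>, both points agree and count as the parallelogram. The inequality kept in the
  other alternative later supplies \<open>b < c\<close>, \<open>a < b\<close> and
  \<open>a < c\<close>.\<close>

lemma reflected_vertex_cases:
  assumes opp: "cross (q - p) (x - p) * cross (q - p) (z - p) < 0"
    and sides: "{#dist p q, dist x p, dist x q#} = {#dist p q, dist z p, dist z q#}"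
  shows "z = p + q - x \<or> dist x p \<noteq> dist x q \<and> z = p + mirror (q - p) (x - p)"
proof -
  have "{#dist x p, dist x q#} = {#dist z p, dist z q#}" using sides by simp
  then have "dist z p = dist x q \<and> dist z q = dist x p \<or>
      dist z p = dist x p \<and> dist z q = dist x q"
    by (auto simp: add_eq_conv_ex)
  then consider "dist z p = dist x q" "dist z q = dist x p" |
      "dist x p \<noteq> dist x q" "dist z p = dist x p" "dist z q = dist x q"
    by fastforce
  then show ?thesis
  proof cases
    case 1
    have *: "dist (p + q - x) p = dist q x" "dist (p + q - x) q = dist p x"
      by (simp_all add: dist_norm)
    have "z = p + q - x"
    proof (rule same_side_eqI)
      show "dist z p = dist (p + q - x) p" "dist z q = dist (p + q - x) q"
        using 1 * by (simp_all add: dist_commute)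
      have e: "cross (q - p) (p + q - x - p) = - cross (q - p) (x - p)"
        by (simp add: cross_def algebra_simps)
      then show "0 < cross (q - p) (z - p) * cross (q - p) (p + q - x - p)"
        using opp by (simp only: e mult_minus_right neg_0_less_iff_less mult.commute)
    qed
    then show ?thesis by simp
  next
    case 2
    have d: "q - p \<noteq> 0" using opp by auto
    have "z = p + mirror (q - p) (x - p)"
    proof (rule same_side_eqI)
      show "dist z p = dist (p + mirror (q - p) (x - p)) p"
        using 2 mirror_props(1)[OF d] by (simp add: dist_norm)
      have "dist (p + mirror (q - p) (x - p)) q = norm (mirror (q - p) (x - p) - (q - p))"
        by (simp add: dist_norm algebra_simps)
      then show "dist z q = dist (p + mirror (q - p) (x - p)) q"
        using 2 mirror_props(2)[OF d, of "x - p"] by (simp add: dist_norm)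
      have e: "cross (q - p) (p + mirror (q - p) (x - p) - p) = - cross (q - p) (x - p)"
        using mirror_props(3)[OF d] by simp
      then show "0 < cross (q - p) (z - p) * cross (q - p) (p + mirror (q - p) (x - p) - p)"
        using opp by (simp only: e mult_minus_right neg_0_less_iff_less mult.commute)
    qed
    with 2 show ?thesis by simp
  qed
qed

section \<open>Neighbouring tiles\<close>

lemma open_segment_on_line:
  fixes p d :: "'a::euclidean_space"
  assumes "d \<noteq> 0"
  shows "p + r *\<^sub>R d \<in> open_segment (p + s *\<^sub>R d) (p + t *\<^sub>R d) \<longleftrightarrow> s < r \<and> r < t \<or> t < r \<and> r < s"
proof -
  have "dist (p + x *\<^sub>R d) (p + y *\<^sub>R d) = \<bar>x - y\<bar> * norm d" for x y
    by (simp add: dist_norm flip: scaleR_left_diff_distrib)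
  then have "p + r *\<^sub>R d \<in> closed_segment (p + s *\<^sub>R d) (p + t *\<^sub>R d) \<longleftrightarrow>
      \<bar>s - t\<bar> * norm d = (\<bar>s - r\<bar> + \<bar>r - t\<bar>) * norm d"
    by (simp add: between_mem_segment[symmetric] between ring_distribs)
  then show ?thesis using assms by (auto simp: open_segment_def)
qed

lemma open_segment_param:
  fixes a b :: "'a::euclidean_space"
  assumes "m \<in> open_segment a b"
  obtains r where "0 < r" "r < 1" "m = a + r *\<^sub>R (b - a)"
  using assms by (auto simp: in_segment algebra_simps)

lemma open_segment_split:
  fixes a b :: "'a::euclidean_space"
  assumes v: "v \<in> open_segment a b" and m: "m \<in> open_segment a b" and "v \<noteq> m"
  shows "v \<in> open_segment m a \<or> v \<in> open_segment m b"
proof -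
  obtain r where r: "0 < r" "r < 1" "v = a + r *\<^sub>R (b - a)" using open_segment_param[OF v] .
  obtain s where s: "0 < s" "s < 1" "m = a + s *\<^sub>R (b - a)" using open_segment_param[OF m] .
  have d: "b - a \<noteq> 0" using v by auto
  have "r \<noteq> s" using r s assms(3) by auto
  then show ?thesis
    using r(1,2) s(1,2) open_segment_on_line[OF d, of a r s 0] open_segment_on_line[OF d, of a r s 1]
    unfolding r(3) s(3) by auto
qed

text \<open>Both segments become intervals around the parameter of \<open>m\<close>. If their end
  points on one side of it differed, the nearer one would lie inside the other interval.\<close>

lemma open_segments_eqI:
  assumes m: "m \<in> open_segment p q" "m \<in> open_segment y y'"
    and out: "y \<notin> open_segment p q" "y' \<notin> open_segment p q" "p \<notin> open_segment y y'" "q \<notin> open_segment y y'"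
    and line: "cross (q - p) (y - p) = 0" "cross (q - p) (y' - p) = 0"
  shows "{y, y'} = {p, q}"
proof -
  define d where "d = q - p"
  have d: "d \<noteq> 0" using m(1) by (auto simp: d_def)
  have on_line: "\<exists>s. x = p + s *\<^sub>R d" if "cross d (x - p) = 0" for x
  proof -
    have "collinear {0, d, x - p}" using that collinear_iff_cross[of 0 d "x - p"] by simp
    then obtain s where "x - p = s *\<^sub>R d" using d collinear_lemma[of d "x - p"] by auto
    then show ?thesis by (intro exI[of _ s]) (simp add: algebra_simps)
  qed
  obtain s s' where y: "y = p + s *\<^sub>R d" "y' = p + s' *\<^sub>R d"
    using on_line line unfolding d_def by blast
  obtain r where r: "0 < r" "r < 1" "m = p + r *\<^sub>R d"
    using open_segment_param[OF m(1)] unfolding d_def .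
  have pq: "p = p + 0 *\<^sub>R d" "q = p + 1 *\<^sub>R d" by (simp_all add: d_def)
  note seg = open_segment_on_line[OF d, of p]
  have "s < r \<and> r < s' \<or> s' < r \<and> r < s" using m(2) unfolding y r(3) seg .
  moreover have "\<not> (0 < s \<and> s < 1)" "\<not> (0 < s' \<and> s' < 1)"
    using out(1,2) seg[of s 0 1] seg[of s' 0 1] unfolding y pq(2)[symmetric] by auto
  moreover have "\<not> (s < 0 \<and> 0 < s' \<or> s' < 0 \<and> 0 < s)" "\<not> (s < 1 \<and> 1 < s' \<or> s' < 1 \<and> 1 < s)"
    using out(3,4) seg[of 0 s s'] seg[of 1 s s'] unfolding y pq(2)[symmetric] by auto
  ultimately have "s = 0 \<and> s' = 1 \<or> s = 1 \<and> s' = 0" using r by linarith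
  then show ?thesis using y pq by auto
qed

text \<open>Side lengths form a multiset, so that isosceles tiles need no separate treatment.\<close>

locale edge_to_edge_tiling =
  fixes a b c :: real and T :: "(real^2) set" and P :: "(real^2) set set"
  assumes finite_tiles: "finite P"
    and tile: "t \<in> P \<Longrightarrow> \<exists>x y z. \<not> collinear {x, y, z} \<and> t = convex hull {x, y, z} \<and>
      {#dist x y, dist z x, dist z y#} = {#a, b, c#}"
    and disjoint: "s \<in> P \<Longrightarrow> t \<in> P \<Longrightarrow> s \<noteq> t \<Longrightarrow> interior s \<inter> interior t = {}"
    and cover: "\<Union>P = T"
    and convex: "convex T"
    and no_hanging: "\<not> hanging_vertex T P x"
begin

lemma tile_triangle: "t \<in> P \<Longrightarrow> triangle t"
  using tile triangle_iff by blast

lemma tile_subset: "t \<in> P \<Longrightarrow> t \<subseteq> T"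
  using cover by blast

text \<open>The form in which the absence of hanging vertices is used. It speaks of interior points
  only, so each application has to place the vertex inside \<open>T\<close>.\<close>

lemma no_corner_in_edge:
  assumes "s \<in> P" "t \<in> P" "s \<noteq> t" "v \<in> corners s"
    and "closed_segment p q edge_of t" "v \<in> open_segment p q"
  shows "v \<notin> interior T"
proof -
  have "p \<noteq> q" using assms(6) by auto
  then have "v \<in> rel_interior (closed_segment p q)"
    using assms(6) by (simp add: rel_interior_closed_segment)
  then show ?thesis
    using no_hanging[of v] assms(1-5) unfolding hanging_vertex_def by blast
qed

text \<open>A triangle determines its set of corners, so the multiset of side lengths does not
  depend on how these are named.\<close>

lemma tile_sides:
  assumes "convex hull {p, q, r} \<in> P" "\<not> collinear {p, q, r}"
  shows "{#dist p q, dist r p, dist r q#} = {#a, b, c#}"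
proof -
  obtain x y z where *: "\<not> collinear {x, y, z}" "convex hull {p, q, r} = convex hull {x, y, z}"
      "{#dist x y, dist z x, dist z y#} = {#a, b, c#}"
    using tile[OF assms(1)] by blast
  have "{p, q, r} = {x, y, z}"
    by (rule corners_hull[OF assms(2), unfolded *(2) corners_hull[OF *(1)], symmetric])
  then have "p \<in> {x, y, z}" "q \<in> {x, y, z}" "r \<in> {x, y, z}" by blast+
  moreover have "p \<noteq> q" "p \<noteq> r" "q \<noteq> r"
    using noncollinear_distinct assms(2) by blast+
  ultimately have "{#dist p q, dist r p, dist r q#} = {#dist x y, dist z x, dist z y#}"
    by (elim insertE emptyE) (simp_all only: dist_commute add_mset_commute simp_thms)
  then show ?thesis using *(3) by simp
qed

text \<open>The other tiles form a closed set. If it missed \<open>x\<close>, a neighbourhood of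
  \<open>x\<close> would be covered by \<open>t\<close> alone.\<close>

lemma second_tile_at_point:
  assumes "t \<in> P" "x \<in> interior T" "x \<notin> interior t"
  obtains s where "s \<in> P" "s \<noteq> t" "x \<in> s"
proof (rule ccontr)
  assume "\<not> thesis"
  then have no: "x \<notin> \<Union>(P - {t})" using that by blast
  have cl: "closed (\<Union>(P - {t}))"
    using finite_tiles tile_triangle triangle_basic(3) by (intro closed_Union) auto
  have "open (interior T - \<Union>(P - {t}))" using cl by (simp add: open_Diff)
  moreover have "interior T - \<Union>(P - {t}) \<subseteq> t"
    using cover interior_subset[of T] by blast
  ultimately have "interior T - \<Union>(P - {t}) \<subseteq> interior t" by (simp add: interior_maximal)
  then show False using assms(2,3) no by blast
qed

text \<open>The midpoint of \<open>pq\<close> is not interior to the given tile, so a second tile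
  contains it. A line separating the two interiors passes through the midpoint, hence through
  \<open>p\<close> and \<open>q\<close>, which leaves the face of the second tile on that line to be
  studied.\<close>

lemma neighbour:
  assumes t: "convex hull {p, q, x} \<in> P" and nc: "\<not> collinear {p, q, x}"
    and inside: "open_segment p q \<subseteq> interior T"
  obtains z where "convex hull {p, q, z} \<in> P" "cross (q - p) (x - p) * cross (q - p) (z - p) < 0"
proof -
  define t where "t = convex hull {p, q, x}"
  define m where "m = midpoint p q"
  note tP = t[folded t_def]
  have pq: "p \<noteq> q" "p \<noteq> x" "q \<noteq> x" using noncollinear_distinct nc by blast+
  have m_open: "m \<in> open_segment p q" using pq by (simp add: m_def)
  have pt: "p \<in> t" "q \<in> t" "x \<in> t" by (auto simp: t_def hull_inc)
  have mt: "m \<in> t"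
    unfolding m_def using closed_segment_subset[OF pt(1,2) triangle_basic(2)[OF tile_triangle[OF tP]]]
    by (meson midpoint_in_closed_segment subsetD)
  have edge: "closed_segment p q edge_of t"
    unfolding t_def by (rule edge_hull[OF nc])
  have cor: "corners t = {p, q, x}" using corners_hull[OF nc] by (simp add: t_def)
  have "m \<notin> interior t"
  proof
    assume "m \<in> interior t"
    then obtain \<alpha> \<beta> \<gamma> where "0 < \<gamma>" "\<alpha> + \<beta> + \<gamma> = 1" "\<alpha> *\<^sub>R p + \<beta> *\<^sub>R q + \<gamma> *\<^sub>R x = m"
      unfolding t_def interior_hull[OF nc] by blast
    then have "\<gamma> *\<^sub>R (x - p) = (1/2 - \<beta>) *\<^sub>R (q - p)"
      unfolding m_def midpoint_def by (simp add: vec_eq_iff forall_2 field_simps) algebra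
    then have "cross (q - p) (\<gamma> *\<^sub>R (x - p)) = cross (q - p) ((1/2 - \<beta>) *\<^sub>R (q - p))"
      by simp
    then have "\<gamma> * cross (q - p) (x - p) = 0"
      by (simp only: cross_simps)
    then show False using \<open>0 < \<gamma>\<close> nc collinear_iff_cross by simp
  qed
  then obtain s where s: "s \<in> P" "s \<noteq> t" "m \<in> s"
    using second_tile_at_point[OF tP] inside m_open by blast
  obtain y1 y2 y3 where y: "\<not> collinear {y1, y2, y3}" "s = convex hull {y1, y2, y3}"
    using tile_triangle[OF s(1)] triangle_iff by blast
  have m_corner: "m \<notin> corners s"
    using no_corner_in_edge[OF s(1) tP s(2) _ edge m_open] inside m_open by blast
  obtain n \<beta> where n: "n \<noteq> 0" "\<And>v. v \<in> interior t \<Longrightarrow> n \<bullet> v \<le> \<beta>" "\<And>v. v \<in> interior s \<Longrightarrow> n \<bullet> v \<ge> \<beta>"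
    using separating_hyperplane_sets[of "interior t" "interior s"] disjoint[OF tP s(1)] s(2)
      tile_triangle[OF tP] tile_triangle[OF s(1)] triangle_basic(2,4) by (metis convex_interior)
  have nt: "n \<bullet> v \<le> \<beta>" if "v \<in> t" for v
  proof -
    have "closure (interior t) \<subseteq> {v. n \<bullet> v \<le> \<beta>}"
      by (rule closure_minimal) (use n in \<open>auto simp: closed_halfspace_le\<close>)
    then show ?thesis using that triangle_basic(5)[OF tile_triangle[OF tP]] by blast
  qed
  have ns: "n \<bullet> v \<ge> \<beta>" if "v \<in> s" for v
  proof -
    have "closure (interior s) \<subseteq> {v. n \<bullet> v \<ge> \<beta>}"
      by (rule closure_minimal) (use n in \<open>auto simp: closed_halfspace_ge\<close>)
    then show ?thesis using that triangle_basic(5)[OF tile_triangle[OF s(1)]] by blast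
  qed
  have nm: "n \<bullet> m = \<beta>" using nt[OF mt] ns[OF s(3)] by simp
  \<comment> \<open>Both values are at most \<open>\<beta>\<close>, and their mean is
    \<open>\<beta>\<close>.\<close>
  then have npq: "n \<bullet> p = \<beta>" "n \<bullet> q = \<beta>"
    using nt[OF pt(1)] nt[OF pt(2)] by (auto simp: m_def midpoint_def inner_add_right)
  have level_cross: "cross (w - v) (u - v) = 0" if "n \<bullet> u = \<beta>" "n \<bullet> v = \<beta>" "n \<bullet> w = \<beta>" for u v w
  proof -
    have *: "n $ 1 * cross x y = y $ 2 * (n \<bullet> x) - x $ 2 * (n \<bullet> y)"
      "n $ 2 * cross x y = x $ 1 * (n \<bullet> y) - y $ 1 * (n \<bullet> x)" for x y
      by (simp_all add: cross_def inner_real2 algebra_simps)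
    have "n \<bullet> (w - v) = 0" "n \<bullet> (u - v) = 0" using that by (simp_all add: inner_diff_right)
    then have "n $ 1 * cross (w - v) (u - v) = 0" "n $ 2 * cross (w - v) (u - v) = 0"
      by (simp_all only: * mult_zero_right diff_self)
    then show ?thesis using n(1) by (auto simp: vec_eq_iff forall_2)
  qed
  have nx: "n \<bullet> x < \<beta>"
    using nt[OF pt(3)] level_cross[OF _ npq] nc collinear_iff_cross[of p q x] by (metis less_eq_real_def)
  text \<open>The face of \<open>s\<close> on the separating line is an edge, as otherwise \<open>m\<close> would hang; and this
    edge coincides with \<open>pq\<close>, as otherwise an end point of one of the two edges would hang.\<close>
  let ?ex = "\<exists>z. convex hull {p, q, z} \<in> P \<and> cross (q - p) (x - p) * cross (q - p) (z - p) < 0"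
  have edge_case: ?ex
    if y: "\<not> collinear {y1, y2, y3}" "s = convex hull {y1, y2, y3}"
      and l: "n \<bullet> y1 = \<beta>" "n \<bullet> y2 = \<beta>" and my: "m \<in> closed_segment y1 y2" for y1 y2 y3
  proof -
    have ys: "y1 \<in> s" "y2 \<in> s" "y3 \<in> s" unfolding y(2) by (simp_all add: hull_inc)
    have yd: "y1 \<noteq> y2" using noncollinear_distinct y(1) by blast
    have cs: "corners s = {y1, y2, y3}" unfolding y(2) by (rule corners_hull[OF y(1)])
    have my': "m \<in> open_segment y1 y2" using my m_corner cs by (simp add: open_segment_def)
    have edge': "closed_segment y1 y2 edge_of s"
      unfolding y(2) by (rule edge_hull[OF y(1)])
    have "y1 \<in> corners s" "y2 \<in> corners s" unfolding cs by simp_all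
    then have "y1 \<notin> open_segment p q" "y2 \<notin> open_segment p q"
      using no_corner_in_edge[OF s(1) tP s(2) _ edge] inside by blast+
    moreover have out: "v \<notin> open_segment y1 y2" if "v \<in> {p, q}" for v
    proof
      assume v: "v \<in> open_segment y1 y2"
      \<comment> \<open>\<open>p\<close> and \<open>q\<close> may be boundary points of
        \<open>T\<close> in general; here \<open>v\<close> lies strictly between the interior point
        \<open>m\<close> and a point of the convex set \<open>T\<close>, which makes it
        interior.\<close>
      have "v \<in> interior T"
      proof -
        have mi: "m \<in> interior T" using inside m_open by blast
        have vm: "v \<noteq> m" using that m_open by (auto simp: open_segment_def)
        have "v \<in> open_segment m y1 \<or> v \<in> open_segment m y2"
          using open_segment_split[OF v my' vm] .
        moreover have "y1 \<in> closure T" "y2 \<in> closure T"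
          using ys s(1) tile_subset closure_subset by blast+
        ultimately show ?thesis
          using in_interior_closure_convex_segment[OF convex mi] by blast
      qed
      then show False
        using no_corner_in_edge[OF tP s(1) s(2)[symmetric] _ edge' v] cor that by blast
    qed
    moreover have "cross (q - p) (y1 - p) = 0" "cross (q - p) (y2 - p) = 0"
      using level_cross[OF _ npq] l by auto
    ultimately have eq: "{y1, y2} = {p, q}"
      using open_segments_eqI[OF m_open my'] by blast
    have hull: "convex hull {p, q, y3} \<in> P"
    proof -
      have "{p, q, y3} = {y1, y2, y3}" using eq by blast
      then show ?thesis using s(1) y(2) by simp
    qed
    have n3: "n \<bullet> y3 > \<beta>"
      using ns[OF ys(3)] level_cross[of y3 y1 y2] l y(1) collinear_iff_cross[of y1 y2 y3] by (metis less_eq_real_def)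
    have "cross (q - p) (x - p) * cross (q - p) (y3 - p) < 0"
    proof -
      \<comment> \<open>As \<open>n\<close> is normal to \<open>pq\<close>, the determinant with
        \<open>q - p\<close> is a fixed multiple of the inner product with \<open>n\<close>, so
        opposite signs of \<open>n \<bullet> v - \<beta>\<close> mean opposite sides of
        \<open>pq\<close>.\<close>
      have "n \<bullet> (q - p) = 0" using npq by (simp add: inner_diff_right)
      then have e: "(n \<bullet> n) * cross (q - p) v = cross (q - p) n * (n \<bullet> v)" for v
        unfolding cross_def inner_real2 by algebra
      have nn: "n \<bullet> n > 0" using n(1) by simp
      have "cross (q - p) n \<noteq> 0"
        using e[of "x - p"] nn nc collinear_iff_cross by auto
      then have "(cross (q - p) n)\<^sup>2 * ((n \<bullet> (x - p)) * (n \<bullet> (y3 - p))) < 0"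
        using npq nx n3 by (intro mult_pos_neg mult_neg_pos) (auto simp: inner_diff_right)
      also have "(cross (q - p) n)\<^sup>2 * ((n \<bullet> (x - p)) * (n \<bullet> (y3 - p))) = 
         (n \<bullet> n)\<^sup>2 * (cross (q - p) (x - p) * cross (q - p) (y3 - p))"
        using e[of "x - p"] e[of "y3 - p"] by (simp only: power2_eq_square) algebra
      finally show ?thesis using nn by (simp add: mult_less_0_iff zero_less_mult_iff)
    qed
    then show ?ex using hull by blast
  qed
  obtain k1 k2 k3 where lam: "0 \<le> k1" "0 \<le> k2" "0 \<le> k3" "k1 + k2 + k3 = 1"
      "m = k1 *\<^sub>R y1 + k2 *\<^sub>R y2 + k3 *\<^sub>R y3"
    using s(3) y(2) convex_hull_3[of y1 y2 y3] by auto
  have yb: "n \<bullet> y1 \<ge> \<beta>" "n \<bullet> y2 \<ge> \<beta>" "n \<bullet> y3 \<ge> \<beta>" using ns y(2) by (auto simp: hull_inc)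
  \<comment> \<open>A vanishing sum of nonnegative terms: each vertex of \<open>s\<close> with
    positive weight at \<open>m\<close> lies on the separating line.\<close>
  have "k1 * (n \<bullet> y1 - \<beta>) + k2 * (n \<bullet> y2 - \<beta>) + k3 * (n \<bullet> y3 - \<beta>) = n \<bullet> m - (k1 + k2 + k3) * \<beta>"
    unfolding lam(5) by (simp add: inner_add_right algebra_simps)
  also have "\<dots> = 0" using nm lam(4) by simp
  finally have z: "k1 * (n \<bullet> y1 - \<beta>) = 0" "k2 * (n \<bullet> y2 - \<beta>) = 0" "k3 * (n \<bullet> y3 - \<beta>) = 0"
    using lam(1-3) yb by (smt (verit) mult_nonneg_nonneg)+
  have not1: "m \<noteq> y1" "m \<noteq> y2" "m \<noteq> y3" using m_corner corners_hull[OF y(1)] y(2) by auto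
  have not_all: "\<not> (n \<bullet> y1 = \<beta> \<and> n \<bullet> y2 = \<beta> \<and> n \<bullet> y3 = \<beta>)"
    using level_cross[of y3 y1 y2] y(1) collinear_iff_cross[of y1 y2 y3] by fastforce
  have conv_seg: "u *\<^sub>R v + u' *\<^sub>R v' \<in> closed_segment v v'" if "u + u' = 1" "0 \<le> u" "0 \<le> u'" 
    for u u' and v v' :: "real^2"
    using that by (auto simp: closed_segment_def intro!: exI[of _ u'])
  \<comment> \<open>One weight vanishes because not all three vertices lie on the line, and no two
    do because \<open>m\<close> is not a corner.\<close>
  consider "k3 = 0" "k1 > 0" "k2 > 0" | "k2 = 0" "k1 > 0" "k3 > 0" | "k1 = 0" "k2 > 0" "k3 > 0"
  proof -
    have "k1 = 0 \<or> k2 = 0 \<or> k3 = 0" using z not_all by auto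
    moreover have "\<not> (k1 = 0 \<and> k2 = 0)" "\<not> (k1 = 0 \<and> k3 = 0)" "\<not> (k2 = 0 \<and> k3 = 0)"
      using lam(4,5) not1 by auto
    ultimately show thesis using that lam(1-3) by (metis less_eq_real_def)
  qed
  then have ?ex
  proof cases
    case 1
    show ?ex by (rule edge_case[OF y]) (use 1 z lam conv_seg[of k1 k2 y1 y2] in auto)
  next
    case 2
    show ?ex 
      by (rule edge_case[of y1 y3 y2]) (use 2 z lam y conv_seg[of k1 k3 y1 y3] in \<open>auto simp: insert_commute\<close>)
  next
    case 3
    show ?ex 
      by (rule edge_case[of y2 y3 y1]) (use 3 z lam y conv_seg[of k2 k3 y2 y3] in \<open>auto simp: insert_commute\<close>)
  qed
  then show thesis using that by blast
qed

lemma neighbour_cases: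
  assumes t: "convex hull {p, q, x} \<in> P" and nc: "\<not> collinear {p, q, x}"
    and inside: "open_segment p q \<subseteq> interior T"
  shows "convex hull {p, q, p + q - x} \<in> P \<or>
    dist x p \<noteq> dist x q \<and> convex hull {p, q, p + mirror (q - p) (x - p)} \<in> P"
proof -
  obtain z where z: "convex hull {p, q, z} \<in> P" "cross (q - p) (x - p) * cross (q - p) (z - p) < 0"
    using neighbour[OF assms] by blast
  then have "\<not> collinear {p, q, z}" using collinear_iff_cross by auto
  then have "{#dist p q, dist x p, dist x q#} = {#dist p q, dist z p, dist z q#}"
    using tile_sides[OF t nc] tile_sides[OF z(1)] by simp
  then show ?thesis using reflected_vertex_cases[OF z(2)] z(1) by auto
qed

end

section \<open>The strip along a side\<close>

definition point :: "real^2 \<Rightarrow> real^2 \<Rightarrow> real^2 \<Rightarrow> real \<Rightarrow> real \<Rightarrow> real^2"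
  where "point A u w x y = A + x *\<^sub>R u + y *\<^sub>R w"

lemmas point_components = point_def vec_eq_iff vector_add_component vector_minus_component
  vector_uminus_component vector_scaleR_component real_scaleR_def

lemma point_surj:
  assumes "cross u w \<noteq> 0"
  obtains x y where "p = point A u w x y"
  using cross_coordinates[OF assms, of "p - A"] that unfolding point_def
  by (metis add.assoc add_diff_cancel_left' diff_add_cancel add.commute)

lemma point_eq_iff:
  assumes "cross u w \<noteq> 0"
  shows "point A u w x y = point A u w x' y' \<longleftrightarrow> x = x' \<and> y = y'"
proof
  assume "point A u w x y = point A u w x' y'"
  then have *: "x *\<^sub>R u + y *\<^sub>R w = x' *\<^sub>R u + y' *\<^sub>R w" by (simp add: point_def)
  have "cross u (x *\<^sub>R u + y *\<^sub>R w) = y * cross u w" "cross (x *\<^sub>R u + y *\<^sub>R w) w = x * cross u w" for x y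
    by simp_all
  then show "x = x' \<and> y = y'" using * assms by (metis mult_cancel_right)
qed simp

lemma point_shift: "point (point A u w i j) u w x y = point A u w (i + x) (j + y)"
  by (simp add: point_def algebra_simps)

lemma noncollinear_frame:
  assumes "cross u w \<noteq> 0"
  shows "\<not> collinear {A, A + u, A + w}"
  using assms by (simp add: collinear_iff_cross)

lemma mem_frame_hull:
  assumes "cross u w \<noteq> 0"
  shows "point A u w x y \<in> convex hull {A, A + u, A + w} \<longleftrightarrow> 0 \<le> x \<and> 0 \<le> y \<and> x + y \<le> 1"
proof -
  have "convex hull {A, A + u, A + w} = {point A u w x y |x y. 0 \<le> x \<and> 0 \<le> y \<and> x + y \<le> 1}"
    unfolding convex_hull_3_alt point_def by simp
  then show ?thesis using point_eq_iff[OF assms] by auto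
qed

lemma mem_interior_frame_hull:
  assumes "cross u w \<noteq> 0"
  shows "point A u w x y \<in> interior (convex hull {A, A + u, A + w}) \<longleftrightarrow> 0 < x \<and> 0 < y \<and> x + y < 1"
proof -
  have e: "z *\<^sub>R A + x *\<^sub>R (A + u) + y *\<^sub>R (A + w) = point A u w x y" if "z + x + y = 1" for x y z
  proof -
    have "z *\<^sub>R A + x *\<^sub>R (A + u) + y *\<^sub>R (A + w) = (z + x + y) *\<^sub>R A + x *\<^sub>R u + y *\<^sub>R w"
      by (simp add: algebra_simps)
    then show ?thesis using that by (simp add: point_def)
  qed
  have "interior (convex hull {A, A + u, A + w}) = {point A u w x y |x y. 0 < x \<and> 0 < y \<and> x + y < 1}"
    (is "_ = ?R")
  proof (intro equalityI subsetI)
    fix v assume "v \<in> interior (convex hull {A, A + u, A + w})"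
    then obtain z x y where "0 < z" "0 < x" "0 < y" "z + x + y = 1"
        "z *\<^sub>R A + x *\<^sub>R (A + u) + y *\<^sub>R (A + w) = v"
      unfolding interior_hull[OF noncollinear_frame[OF assms]] by blast
    then show "v \<in> ?R" using e[of z x y] by (intro CollectI exI[of _ x] exI[of _ y]) auto
  next
    fix v assume "v \<in> ?R"
    then obtain x y where "v = point A u w x y" "0 < x" "0 < y" "x + y < 1" by blast
    then show "v \<in> interior (convex hull {A, A + u, A + w})"
      unfolding interior_hull[OF noncollinear_frame[OF assms]]
      using e[of "1 - x - y" x y]
      by (intro CollectI exI[of _ "1 - x - y"] exI[of _ x] exI[of _ y]) auto
  qed
  then show ?thesis using point_eq_iff[OF assms] by auto
qed

text \<open>\<open>up\<close> and \<open>down\<close> are the halves of a unit cell. The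
  parallelogram partner of either kind across any of its edges is a tile of the other kind.\<close>

definition up :: "real^2 \<Rightarrow> real^2 \<Rightarrow> real^2 \<Rightarrow> real \<Rightarrow> real \<Rightarrow> (real^2) set"
  where "up A u w x y = convex hull {point A u w x y, point A u w (x + 1) y, point A u w x (y + 1)}"

definition down :: "real^2 \<Rightarrow> real^2 \<Rightarrow> real^2 \<Rightarrow> real \<Rightarrow> real \<Rightarrow> (real^2) set"
  where "down A u w x y =
    convex hull {point A u w (x + 1) y, point A u w x (y + 1), point A u w (x + 1) (y + 1)}"

lemma up_shift: "up (point A u w i j) u w x y = up A u w (i + x) (j + y)"
  by (simp add: up_def point_shift add.assoc)

lemma down_shift: "down (point A u w i j) u w x y = down A u w (i + x) (j + y)"
  by (simp add: down_def point_shift add.assoc)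

lemma up_frame: "up A u w i j = convex hull {point A u w i j, point A u w i j + u, point A u w i j + w}"
  by (simp add: up_def point_def algebra_simps)

text \<open>Seen from its far corner, a \<open>down\<close> tile is spanned by \<open>- u\<close>
  and \<open>- w\<close>, so the membership criterion for frames serves both kinds.\<close>

lemma down_frame:
  "down A u w i j = convex hull {point A u w (i + 1) (j + 1), point A u w (i + 1) (j + 1) + - u,
    point A u w (i + 1) (j + 1) + - w}"
proof -
  have "{point A u w (i + 1) j, point A u w i (j + 1), point A u w (i + 1) (j + 1)} =
    {point A u w (i + 1) (j + 1), point A u w (i + 1) (j + 1) + - u, point A u w (i + 1) (j + 1) + - w}"
    by (auto simp: point_def algebra_simps)
  then show ?thesis by (simp only: down_def)
qed

lemma mem_up:
  assumes "cross u w \<noteq> 0"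
  shows "point A u w x y \<in> up A u w i j \<longleftrightarrow> i \<le> x \<and> j \<le> y \<and> x + y \<le> i + j + 1"
    and "point A u w x y \<in> interior (up A u w i j) \<longleftrightarrow> i < x \<and> j < y \<and> x + y < i + j + 1"
proof -
  have e: "point A u w x y = point (point A u w i j) u w (x - i) (y - j)"
    by (simp add: point_shift)
  show "point A u w x y \<in> up A u w i j \<longleftrightarrow> i \<le> x \<and> j \<le> y \<and> x + y \<le> i + j + 1"
    unfolding up_frame e mem_frame_hull[OF assms] by auto
  show "point A u w x y \<in> interior (up A u w i j) \<longleftrightarrow> i < x \<and> j < y \<and> x + y < i + j + 1"
    unfolding up_frame e mem_interior_frame_hull[OF assms] by auto
qed

lemma mem_down:
  assumes "cross u w \<noteq> 0"
  shows "point A u w x y \<in> down A u w i j \<longleftrightarrow> x \<le> i + 1 \<and> y \<le> j + 1 \<and> i + j + 1 \<le> x + y"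
    and "point A u w x y \<in> interior (down A u w i j) \<longleftrightarrow> x < i + 1 \<and> y < j + 1 \<and> i + j + 1 < x + y"
proof -
  have e: "point A u w x y = point (point A u w (i + 1) (j + 1)) (- u) (- w) (i + 1 - x) (j + 1 - y)"
    by (simp add: point_def algebra_simps)
  have n: "cross (- u) (- w) \<noteq> 0" using assms by simp
  show "point A u w x y \<in> down A u w i j \<longleftrightarrow> x \<le> i + 1 \<and> y \<le> j + 1 \<and> i + j + 1 \<le> x + y"
    unfolding down_frame e mem_frame_hull[OF n] by auto
  show "point A u w x y \<in> interior (down A u w i j) \<longleftrightarrow> x < i + 1 \<and> y < j + 1 \<and> i + j + 1 < x + y"
    unfolding down_frame e mem_interior_frame_hull[OF n] by auto
qed

lemma mem_scaled_hull:
  assumes "cross u w \<noteq> 0" "k > 0" "l > 0"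
  shows "point A u w x y \<in> convex hull {A, A + k *\<^sub>R u, A + l *\<^sub>R w} \<longleftrightarrow>
      0 \<le> x \<and> 0 \<le> y \<and> x / k + y / l \<le> 1"
    and "point A u w x y \<in> interior (convex hull {A, A + k *\<^sub>R u, A + l *\<^sub>R w}) \<longleftrightarrow>
      0 < x \<and> 0 < y \<and> x / k + y / l < 1"
proof -
  have e: "point A u w x y = point A (k *\<^sub>R u) (l *\<^sub>R w) (x / k) (y / l)"
    using assms by (simp add: point_def)
  have n: "cross (k *\<^sub>R u) (l *\<^sub>R w) \<noteq> 0" using assms by simp
  show "point A u w x y \<in> convex hull {A, A + k *\<^sub>R u, A + l *\<^sub>R w} \<longleftrightarrow>
      0 \<le> x \<and> 0 \<le> y \<and> x / k + y / l \<le> 1"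
    unfolding e mem_frame_hull[OF n] using assms(2,3) by (simp add: zero_le_divide_iff)
  show "point A u w x y \<in> interior (convex hull {A, A + k *\<^sub>R u, A + l *\<^sub>R w}) \<longleftrightarrow>
      0 < x \<and> 0 < y \<and> x / k + y / l < 1"
    unfolding e mem_interior_frame_hull[OF n] using assms(2,3) by (simp add: zero_less_divide_iff)
qed

text \<open>\<open>u\<close> carries the middle side of the corner tile, \<open>w\<close> the
  longest. The factors \<open>k\<close> and \<open>l\<close> are kept apart so that
  \<open>strip\<close> also applies to a corner tile lying reversed in \<open>T\<close>.\<close>

locale corner_tiling = edge_to_edge_tiling +
  fixes A u w :: "real^2" and k l :: real
  assumes frame: "cross u w \<noteq> 0"
    and pos: "k > 0" "l > 0"
    and T_eq: "T = convex hull {A, A + k *\<^sub>R u, A + l *\<^sub>R w}"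
    and norms: "norm u = b" "norm w = c" "norm (w - u) = a"
    and order: "a \<le> b" "b \<le> c"
    and not_right: "a\<^sup>2 + b\<^sup>2 \<noteq> c\<^sup>2"
    and start: "up A u w 0 0 \<in> P"
begin

abbreviation "pt \<equiv> point A u w"

lemmas mem_T = mem_scaled_hull[OF frame pos, of A, folded T_eq]

lemma a_pos: "a > 0"
  using frame norms(3) by (cases "w = u") auto

lemma b_pos: "b > 0" and c_pos: "c > 0"
  using a_pos order by auto

lemma inners:
  "u \<bullet> u = b\<^sup>2" "w \<bullet> w = c\<^sup>2" "u \<bullet> w = (b\<^sup>2 + c\<^sup>2 - a\<^sup>2) / 2" "w \<bullet> u = (b\<^sup>2 + c\<^sup>2 - a\<^sup>2) / 2"
proof -
  show 1: "u \<bullet> u = b\<^sup>2" "w \<bullet> w = c\<^sup>2" using norms by (auto simp: power2_norm_eq_inner)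
  have "a\<^sup>2 = (w - u) \<bullet> (w - u)"
    unfolding norms(3)[symmetric] by (rule power2_norm_eq_inner)
  also have "\<dots> = c\<^sup>2 - 2 * (u \<bullet> w) + b\<^sup>2"
    using 1 by (simp add: inner_diff_left inner_diff_right inner_commute)
  finally show "u \<bullet> w = (b\<^sup>2 + c\<^sup>2 - a\<^sup>2) / 2" by simp
  then show "w \<bullet> u = (b\<^sup>2 + c\<^sup>2 - a\<^sup>2) / 2" by (simp add: inner_commute)
qed

text \<open>The source of the contradictions below: a supposed tile has a vertex with a negative
  coordinate.\<close>

lemma hull_mem_T: "convex hull {p, q, pt x y} \<in> P \<Longrightarrow> 0 \<le> x \<and> 0 \<le> y \<and> x / k + y / l \<le> 1"
  using mem_T(1) tile_subset hull_inc[of "pt x y" "{p, q, pt x y}"] by blast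

lemma open_segment_points:
  assumes "v \<in> open_segment (pt x y) (pt x' y')"
  obtains s where "0 < s" "s < 1" "v = pt ((1 - s) * x + s * x') ((1 - s) * y + s * y')"
proof -
  obtain s where "0 < s" "s < 1" "v = (1 - s) *\<^sub>R pt x y + s *\<^sub>R pt x' y'"
    using assms by (auto simp: in_segment)
  then show thesis using that[of s] by (simp add: point_def algebra_simps)
qed

text \<open>At the base point the first coordinate and the distance to the third side are positive,
  at the other end the second coordinate is; in between all three are.\<close>

lemma base_segment_interior:
  assumes "0 < x" "x < k" and y: "0 < y'" "0 \<le> x'" "x' / k + y' / l \<le> 1"
  shows "open_segment (pt x 0) (pt x' y') \<subseteq> interior T"
proof
  fix v assume "v \<in> open_segment (pt x 0) (pt x' y')"
  then obtain s where s: "0 < s" "s < 1" "v = pt ((1 - s) * x + s * x') (s * y')"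
    using open_segment_points by (metis add_0 mult_zero_right)
  have "((1 - s) * x + s * x') / k + s * y' / l = (1 - s) * (x / k) + s * (x' / k + y' / l)"
    by (simp add: add_divide_distrib ring_distribs)
  also have "\<dots> < (1 - s) * 1 + s * 1"
    using s(1,2) assms pos by (intro add_less_le_mono mult_strict_left_mono mult_left_mono) auto
  finally have "((1 - s) * x + s * x') / k + s * y' / l < 1" by simp
  moreover have "0 < (1 - s) * x + s * x'" using s(1,2) assms by (intro add_pos_nonneg) auto
  moreover have "0 < s * y'" using s(1) y(1) by simp
  ultimately show "v \<in> interior T" unfolding s(3) mem_T(2) by blast
qed

lemma cross_points: "cross (pt x y - pt x0 y0) (pt x' y' - pt x0 y0) =
    ((x - x0) * (y' - y0) - (x' - x0) * (y - y0)) * cross u w"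
  unfolding point_def cross_def vector_add_component vector_minus_component vector_scaleR_component
  by (simp add: algebra_simps)

lemma noncollinear_points:
  "(x - x0) * (y' - y0) \<noteq> (x' - x0) * (y - y0) \<Longrightarrow> \<not> collinear {pt x0 y0, pt x y, pt x' y'}"
  unfolding collinear_iff_cross cross_points using frame by simp

text \<open>If the neighbour were the mirror image, then either it or the tile next to it around the
  boundary point \<open>pt (x + 1) 0\<close> would cross the side \<open>y = 0\<close> of \<open>T\<close>: the angle left over at that
  point is smaller than every angle of a tile.\<close>

lemma down_tile:
  assumes t: "up A u w x 0 \<in> P" and x: "0 \<le> x" "x + 1 \<noteq> k"
  shows "down A u w x 0 \<in> P"
proof (rule ccontr)
  assume no: "down A u w x 0 \<notin> P"
  define g where "g = w - u"
  \<comment> \<open>By the law of cosines \<open>h\<close> is \<open>2 * a * b\<close> times the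
    cosine of the largest tile angle, the one at \<open>pt (x + 1) 0\<close>; \<open>q\<close> will
    be the second coordinate of the mirrored vertex.\<close>
  define h where "h = a\<^sup>2 + b\<^sup>2 - c\<^sup>2"
  define q where "q = h / a\<^sup>2"
  have t1: "convex hull {pt (x + 1) 0, pt x 1, pt x 0} \<in> P"
    using t by (simp add: up_def insert_commute)
  have t2: "convex hull {pt x 1, pt x 0, pt (x + 1) 0} \<in> P"
    using t by (simp add: up_def insert_commute)
  \<comment> \<open>The base of the tile ends in \<open>T\<close>, and
    \<open>x + 1 \<noteq> k\<close> keeps this end off the corner of \<open>T\<close>.\<close>
  have xk: "0 < x + 1" "x + 1 < k" using hull_mem_T[OF t2] x pos by auto
  have top: "x / k + 1 / l \<le> 1" using t hull_mem_T[of "pt x 0" "pt (x + 1) 0" x 1] by (simp add: up_def)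
  have nb: "dist (pt x 0) (pt (x + 1) 0) \<noteq> dist (pt x 0) (pt x 1)"
    and M: "convex hull {pt (x + 1) 0, pt x 1,
      pt (x + 1) 0 + mirror (pt x 1 - pt (x + 1) 0) (pt x 0 - pt (x + 1) 0)} \<in> P"
  proof -
    have "pt (x + 1) 0 + pt x 1 - pt x 0 = pt (x + 1) 1" by (simp only: point_components) (simp add: algebra_simps)
    then have "convex hull {pt (x + 1) 0, pt x 1, pt (x + 1) 0 + pt x 1 - pt x 0} \<notin> P"
      using no by (simp add: down_def)
    moreover have "\<not> collinear {pt (x + 1) 0, pt x 1, pt x 0}" by (rule noncollinear_points) simp
    moreover have "open_segment (pt (x + 1) 0) (pt x 1) \<subseteq> interior T"
      by (rule base_segment_interior) (use xk x top in auto)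
    ultimately show "dist (pt x 0) (pt (x + 1) 0) \<noteq> dist (pt x 0) (pt x 1)"
      "convex hull {pt (x + 1) 0, pt x 1,
      pt (x + 1) 0 + mirror (pt x 1 - pt (x + 1) 0) (pt x 0 - pt (x + 1) 0)} \<in> P"
      using neighbour_cases[OF t1] by blast+
  qed
  have "pt x 0 - pt (x + 1) 0 = - u" "pt x 0 - pt x 1 = - w"
    by (simp_all only: point_components) (simp_all add: algebra_simps)
  then have bc: "b < c" using nb norms order by (simp add: dist_norm)
  have gg: "g \<bullet> g = a\<^sup>2"
    unfolding g_def norms(3)[symmetric] by (rule power2_norm_eq_inner[symmetric])
  have ug: "u \<bullet> g = - h / 2" "g \<bullet> u = - h / 2"
    by (simp_all add: g_def h_def inner_diff_left inner_diff_right inners field_simps)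
  have d1: "pt x 1 - pt (x + 1) 0 = g" "pt x 0 - pt (x + 1) 0 = - u"
    by (simp_all only: g_def point_components) (simp_all add: algebra_simps)
  have mg: "mirror g (- u) = q *\<^sub>R g + u"
    by (simp add: mirror_def gg ug q_def)
  have z: "pt (x + 1) 0 + mirror (pt x 1 - pt (x + 1) 0) (pt x 0 - pt (x + 1) 0) = pt (x + 2 - q) q"
    unfolding d1 mg by (simp only: g_def point_components) (simp add: algebra_simps)
  note t3 = M[unfolded z]
  have a2: "0 < a\<^sup>2" "0 < b\<^sup>2" using a_pos b_pos by simp_all
  have zT: "0 \<le> x + 2 - q" "0 \<le> q" "(x + 2 - q) / k + q / l \<le> 1" using hull_mem_T[OF t3] by auto
  \<comment> \<open>The step that rests on obliqueness: \<open>q = 0\<close> would put the mirrored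
    vertex on the base, two right angles filling the straight angle.\<close>
  have q0: "0 < q" using zT(2) not_right a_pos by (simp add: q_def h_def less_le)
  have h0: "0 < h" using q0 a2 by (simp add: q_def zero_less_divide_iff)
  have ha: "h < a\<^sup>2" using bc b_pos power_strict_mono[of b c 2] by (simp add: h_def)
  have q1: "q < 1" using ha a2 by (simp add: q_def)
  \<comment> \<open>Next comes the tile across the edge from \<open>pt (x + 1) 0\<close> to the
    mirrored vertex, an inner edge because \<open>q > 0\<close>.\<close>
  have t4: "convex hull {pt (x + 1) 0, pt (x + 2 - q) q, pt x 1} \<in> P"
    using t3 by (simp add: insert_commute)
  have "\<not> collinear {pt (x + 1) 0, pt (x + 2 - q) q, pt x 1}"
    by (rule noncollinear_points) (simp add: algebra_simps)
  moreover have "open_segment (pt (x + 1) 0) (pt (x + 2 - q) q) \<subseteq> interior T"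
    by (rule base_segment_interior) (use xk zT q0 in auto)
  ultimately consider "convex hull {pt (x + 1) 0, pt (x + 2 - q) q, pt (x + 1) 0 + pt (x + 2 - q) q - pt x 1} \<in> P"
    | "convex hull {pt (x + 1) 0, pt (x + 2 - q) q, pt (x + 1) 0 +
        mirror (pt (x + 2 - q) q - pt (x + 1) 0) (pt x 1 - pt (x + 1) 0)} \<in> P"
    using neighbour_cases[OF t4] by blast
  then show False
  proof cases
    case 1
    \<comment> \<open>The partner contributes the smallest tile angle, already too large for the gap
      since \<open>b < c\<close>.\<close>
    have "pt (x + 1) 0 + pt (x + 2 - q) q - pt x 1 = pt (x + 3 - q) (q - 1)"
      by (simp only: point_components) (simp add: algebra_simps)
    then show False using 1 hull_mem_T q1 by fastforce
  next
    case 2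
    \<comment> \<open>\<open>r\<close> is the edge to the mirrored vertex. A third copy of the
      largest angle exceeds the straight angle: the new vertex has second coordinate
      \<open>e * q - 1\<close>, with both factors below 1.\<close>
    define r where "r = q *\<^sub>R g + u"
    have qa: "q * a\<^sup>2 = h" using a2 by (simp add: q_def)
    have "r \<bullet> r = q * (q * a\<^sup>2) - q * h + b\<^sup>2"
      by (simp add: r_def inner_add_left inner_add_right gg ug inners) (simp add: algebra_simps)
    then have rr: "r \<bullet> r = b\<^sup>2" using qa by simp
    define e where "e = h / b\<^sup>2"
    have "g \<bullet> r = h / 2"
      using qa by (simp add: r_def inner_add_left inner_add_right gg ug)
    then have m: "mirror r g = e *\<^sub>R r - g" by (simp add: mirror_def rr e_def)
    have d2: "pt (x + 2 - q) q - pt (x + 1) 0 = r"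
      by (simp only: r_def g_def point_components) (simp add: algebra_simps)
    have "pt (x + 1) 0 + mirror (pt (x + 2 - q) q - pt (x + 1) 0) (pt x 1 - pt (x + 1) 0) =
        pt (x + 2 + e * (1 - q)) (e * q - 1)"
      unfolding d1 d2 m by (simp only: r_def g_def point_components) (simp add: algebra_simps)
    then have "0 \<le> e * q - 1" using 2 hull_mem_T by metis
    moreover have "e * q < 1"
    proof -
      have "a\<^sup>2 \<le> b\<^sup>2" using order(1) a_pos by (simp add: power_mono)
      then have "h < b\<^sup>2" using ha by simp
      then have "e < 1" using a2 by (simp add: e_def)
      then have "e * q < 1 * q" using q0 by (rule mult_strict_right_mono)
      then show ?thesis using q1 by simp
    qed
    ultimately show False by simp
  qed
qed

text \<open>Between the edge along \<open>w\<close> and the base, only the smallest tile angle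
  remains at \<open>pt (x + 1) 0\<close>. The mirror image would bring the angle opposite
  \<open>b\<close>, which is larger as \<open>a < b\<close> in that case.\<close>

lemma next_up_tile:
  assumes t: "down A u w x 0 \<in> P" and x: "0 \<le> x" "x + 1 \<noteq> k"
  shows "up A u w (x + 1) 0 \<in> P"
proof (rule ccontr)
  assume no: "up A u w (x + 1) 0 \<notin> P"
  have t1: "convex hull {pt (x + 1) 0, pt (x + 1) 1, pt x 1} \<in> P"
    using t by (simp add: down_def insert_commute)
  have t2: "convex hull {pt (x + 1) 1, pt x 1, pt (x + 1) 0} \<in> P"
    using t by (simp add: down_def insert_commute)
  have xk: "0 < x + 1" "x + 1 < k" using hull_mem_T[OF t2] x pos by auto
  have top: "(x + 1) / k + 1 / l \<le> 1" using hull_mem_T[of "pt (x + 1) 0" "pt x 1" "x + 1" 1] t by (simp add: down_def)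
  have "pt (x + 1) 0 + pt (x + 1) 1 - pt x 1 = pt (x + 2) 0" by (simp only: point_components) (simp add: algebra_simps)
  then have "convex hull {pt (x + 1) 0, pt (x + 1) 1, pt (x + 1) 0 + pt (x + 1) 1 - pt x 1} \<notin> P"
    using no by (simp add: up_def insert_commute add.commute)
  moreover have "\<not> collinear {pt (x + 1) 0, pt (x + 1) 1, pt x 1}" by (rule noncollinear_points) simp
  moreover have "open_segment (pt (x + 1) 0) (pt (x + 1) 1) \<subseteq> interior T"
    by (rule base_segment_interior) (use xk top in auto)
  ultimately have nb: "dist (pt x 1) (pt (x + 1) 0) \<noteq> dist (pt x 1) (pt (x + 1) 1)"
    and M: "convex hull {pt (x + 1) 0, pt (x + 1) 1,
      pt (x + 1) 0 + mirror (pt (x + 1) 1 - pt (x + 1) 0) (pt x 1 - pt (x + 1) 0)} \<in> P"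
    using neighbour_cases[OF t1] by blast+
  have d: "pt (x + 1) 1 - pt (x + 1) 0 = w" "pt x 1 - pt (x + 1) 0 = w - u" "pt x 1 - pt (x + 1) 1 = - u"
    by (simp_all only: point_components) (simp_all add: algebra_simps)
  have ab: "a < b" using nb norms order unfolding dist_norm d by simp
  define q where "q = (a\<^sup>2 + c\<^sup>2 - b\<^sup>2) / c\<^sup>2"
  have "(w - u) \<bullet> w * 2 = a\<^sup>2 + c\<^sup>2 - b\<^sup>2" by (simp add: inner_diff_left inners field_simps)
  then have m: "mirror w (w - u) = q *\<^sub>R w - (w - u)" by (simp add: mirror_def inners q_def)
  have "pt (x + 1) 0 + mirror (pt (x + 1) 1 - pt (x + 1) 0) (pt x 1 - pt (x + 1) 0) = pt (x + 2) (q - 1)"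
    unfolding d m by (simp only: point_components) (simp add: algebra_simps)
  then have "0 \<le> q - 1" using M hull_mem_T by metis
  moreover have "q < 1"
    using ab a_pos power_strict_mono[of a b 2] c_pos by (simp add: q_def)
  ultimately show False by simp
qed

text \<open>This supplies the starting tile, the right way round, for the triangle left after
  removing the strip. Between the edge along \<open>u\<close> and the side \<open>x = 0\<close> only
  the smallest angle remains at \<open>pt 0 1\<close>, whereas the mirror image would bring the
  largest.\<close>

lemma next_row_tile:
  assumes t: "down A u w 0 0 \<in> P" and "k = l"
  shows "up A u w 0 1 \<in> P"
proof (rule ccontr)
  assume no: "up A u w 0 1 \<notin> P"
  have t1: "convex hull {pt 0 1, pt 1 1, pt 1 0} \<in> P"
    using t by (simp add: down_def insert_commute)
  have "1 / k + 1 / l \<le> 1" using hull_mem_T[of "pt 1 0" "pt 0 1" 1 1] t by (simp add: down_def)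
  then have top: "2 / k \<le> 1" using \<open>k = l\<close> by simp
  have "pt 0 1 + pt 1 1 - pt 1 0 = pt 0 2" by (simp only: point_components) (simp add: algebra_simps)
  then have "convex hull {pt 0 1, pt 1 1, pt 0 1 + pt 1 1 - pt 1 0} \<notin> P"
    using no by (simp add: up_def insert_commute)
  moreover have "\<not> collinear {pt 0 1, pt 1 1, pt 1 0}" by (rule noncollinear_points) simp
  moreover have "open_segment (pt 0 1) (pt 1 1) \<subseteq> interior T"
  proof
    fix v assume "v \<in> open_segment (pt 0 1) (pt 1 1)"
    then obtain s where s: "0 < s" "s < 1" "v = pt s 1" using open_segment_points[of v 0 1 1 1] by auto
    have "s / k + 1 / l < 2 / k" using s pos \<open>k = l\<close> by (simp add: field_simps)
    then show "v \<in> interior T" unfolding s(3) mem_T(2) using s top by auto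
  qed
  ultimately have nb: "dist (pt 1 0) (pt 0 1) \<noteq> dist (pt 1 0) (pt 1 1)"
    and M: "convex hull {pt 0 1, pt 1 1, pt 0 1 + mirror (pt 1 1 - pt 0 1) (pt 1 0 - pt 0 1)} \<in> P"
    using neighbour_cases[OF t1] by blast+
  have d: "pt 1 1 - pt 0 1 = u" "pt 1 0 - pt 0 1 = u - w" "pt 1 0 - pt 1 1 = - w"
    by (simp_all only: point_components) (simp_all add: algebra_simps)
  have ac: "a < c" using nb norms order unfolding dist_norm d by (simp add: norm_minus_commute)
  define q where "q = (a\<^sup>2 + b\<^sup>2 - c\<^sup>2) / b\<^sup>2"
  have "2 * ((u - w) \<bullet> u) = a\<^sup>2 + b\<^sup>2 - c\<^sup>2" by (simp add: inner_diff_left inners field_simps)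
  then have m: "mirror u (u - w) = q *\<^sub>R u - (u - w)" by (simp add: mirror_def inners q_def)
  have "pt 0 1 + mirror (pt 1 1 - pt 0 1) (pt 1 0 - pt 0 1) = pt (q - 1) 2"
    unfolding d m by (simp only: point_components) (simp add: algebra_simps)
  then have "0 \<le> q - 1" using M hull_mem_T by metis
  moreover have "q < 1"
    using ac a_pos power_strict_mono[of a c 2] b_pos by (simp add: q_def)
  ultimately show False by simp
qed

text \<open>The walk can stop only at a tile whose base ends in a corner of \<open>T\<close>, and it
  must stop because \<open>T\<close> is bounded.\<close>

lemma strip:
  obtains m :: nat where "m \<ge> 1" "k = real m"
    "\<And>i. i < m \<Longrightarrow> up A u w (real i) 0 \<in> P" "\<And>i. i + 1 < m \<Longrightarrow> down A u w (real i) 0 \<in> P"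
proof -
  have ups: "up A u w (real i) 0 \<in> P" if "\<And>j. j < i \<Longrightarrow> real j + 1 \<noteq> k" for i
    using that
  proof (induction i)
    case 0
    then show ?case using start by simp
  next
    case (Suc i)
    have n: "real i + 1 \<noteq> k" using Suc.prems by blast
    have "up A u w (real i) 0 \<in> P" using Suc by simp
    then have "up A u w (real i + 1) 0 \<in> P" using down_tile next_up_tile n by simp
    then show ?case by (simp add: add.commute)
  qed
  have "\<exists>j. real j + 1 = k"
  proof (rule ccontr)
    assume no: "\<nexists>j. real j + 1 = k"
    obtain i :: nat where i: "k < real i" using reals_Archimedean2 by blast
    have "up A u w (real i) 0 \<in> P" using ups no by blast
    then have "pt (real i) 0 \<in> T" using tile_subset mem_up(1)[OF frame] by fastforce
    then show False using mem_T(1)[of "real i" 0] i pos by simp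
  qed
  then obtain j where j: "real j + 1 = k" by blast
  show thesis
  proof (rule that[of "j + 1"])
    show "up A u w (real i) 0 \<in> P" if "i < j + 1" for i
      using ups that j by force
    show "down A u w (real i) 0 \<in> P" if "i + 1 < j + 1" for i
      by (rule down_tile) (use ups[of i] that j in force)+
  qed (use j in auto)
qed

end

section \<open>Removing strips, and the trivial reptiling\<close>

lemma grid_tiles:
  assumes "corner_tiling a b c T P A u w k k"
  shows "\<exists>m::nat. m \<ge> 1 \<and> k = real m \<and>
    (\<forall>t\<in>P. \<exists>i j::nat. t = up A u w (real i) (real j) \<or> t = down A u w (real i) (real j))"
  using assms
proof (induction "card P" arbitrary: T P A k rule: less_induct)
  case less
  interpret corner_tiling a b c T P A u w k k by (fact less.prems)
  obtain m :: nat where m: "m \<ge> 1" "k = real m"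
    and strip_up: "\<And>i. i < m \<Longrightarrow> up A u w (real i) 0 \<in> P"
    and strip_down: "\<And>i. i + 1 < m \<Longrightarrow> down A u w (real i) 0 \<in> P"
    using strip by blast
  have inT: "pt x y \<in> T \<longleftrightarrow> 0 \<le> x \<and> 0 \<le> y \<and> x + y \<le> k" for x y
    using mem_T(1) pos by (simp add: field_simps)
  show ?case
  proof (cases "m = 1")
    case True
    have "T = up A u w 0 0" using T_eq m True by (simp add: up_def point_def)
    moreover have "t = up A u w 0 0" if "t \<in> P" for t
    proof (rule ccontr)
      assume "t \<noteq> up A u w 0 0"
      then have "interior t \<inter> interior T = {}"
        using disjoint[OF that start] \<open>T = up A u w 0 0\<close> by simp
      moreover have "interior t \<subseteq> interior T" using tile_subset[OF that] by (rule interior_mono)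
      ultimately show False using triangle_basic(4)[OF tile_triangle[OF that]] by blast
    qed
    ultimately show ?thesis using m
      by (intro exI[of _ m]) (auto intro!: exI[of _ "0::nat"])
  next
    case False
    then have m2: "1 < m" using m by simp
    define A' where "A' = pt 0 1"
    define T' where "T' = convex hull {A', A' + (k - 1) *\<^sub>R u, A' + (k - 1) *\<^sub>R w}"
    define P' where "P' = {t \<in> P. t \<subseteq> T'}"
    define S where "S = {up A u w (real i) 0 |i. i < m} \<union> {down A u w (real i) 0 |i. i + 1 < m}"
    have k1: "k - 1 > 0" using m m2 by simp
    have shift: "pt x y = point A' u w x (y - 1)" for x y by (simp add: A'_def point_shift)
    have inT': "pt x y \<in> T' \<longleftrightarrow> 0 \<le> x \<and> 1 \<le> y \<and> x + y \<le> k"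
      and intT': "pt x y \<in> interior T' \<longleftrightarrow> 0 < x \<and> 1 < y \<and> x + y < k" for x y
      unfolding shift T'_def mem_scaled_hull[OF frame k1 k1] using k1
      by (auto simp: divide_le_eq divide_less_eq simp flip: add_divide_distrib)
    have "cross ((k - 1) *\<^sub>R u) ((k - 1) *\<^sub>R w) \<noteq> 0" using frame k1 by simp
    then have T': "triangle T'"
      unfolding T'_def triangle_iff using noncollinear_frame by blast
    have T'T: "T' \<subseteq> T"
    proof
      fix v assume "v \<in> T'"
      moreover obtain x y where "v = pt x y" using point_surj[OF frame] by blast
      ultimately show "v \<in> T" using inT inT' by auto
    qed
    have SP: "S \<subseteq> P" using strip_up strip_down by (auto simp: S_def)
    have S_low: "y \<le> 1" if "s \<in> S" "pt x y \<in> s" for s x y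
      using that mem_up(1)[OF frame] mem_down(1)[OF frame] by (auto simp: S_def)
    have S_cover: "\<exists>s\<in>S. pt x y \<in> s" if xy: "pt x y \<in> T" "y \<le> 1" for x y
    proof -
      define i where "i = nat \<lfloor>x\<rfloor>"
      have b: "0 \<le> x" "0 \<le> y" "x + y \<le> real m" using xy inT m by auto
      then have i: "real i \<le> x" "x < real i + 1" by (auto simp: i_def)
      show ?thesis
      proof (cases "x + y \<le> real i + 1")
        case low: True
        show ?thesis
        proof (cases "i < m")
          case True
          then have "up A u w (real i) 0 \<in> S" by (auto simp: S_def)
          moreover have "pt x y \<in> up A u w (real i) 0" using mem_up(1)[OF frame] i b low by simp
          ultimately show ?thesis by blast
        next
          case False
          \<comment> \<open>Only the corner \<open>x = m\<close>, \<open>y = 0\<close> gets here; it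
            belongs to the last \<open>up\<close> tile, of index \<open>m - 1\<close>.\<close>
          then have "real m \<le> real i" by simp
          moreover have "up A u w (real (m - 1)) 0 \<in> S"
            unfolding S_def by (rule UnI1, rule CollectI, rule exI[of _ "m - 1"]) (use m in auto)
          moreover have "real (m - 1) = real m - 1" using m by (simp add: of_nat_diff)
          then have "pt x y \<in> up A u w (real (m - 1)) 0"
            using mem_up(1)[OF frame] i b \<open>real m \<le> real i\<close> by simp
          ultimately show ?thesis by blast
        qed
      next
        case False
        then have "real i + 1 < real m" using b by simp
        then have "i + 1 < m" by linarith
        then have "down A u w (real i) 0 \<in> S" by (auto simp: S_def)
        moreover have "pt x y \<in> down A u w (real i) 0" using mem_down(1)[OF frame] i b False xy(2) by simp
        ultimately show ?thesis by blast
      qed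
    qed
    have rest: "t \<subseteq> T'" if t: "t \<in> P" "t \<notin> S" for t
    proof -
      have "interior t \<subseteq> T'"
      proof
        fix v assume v: "v \<in> interior t"
        obtain x y where xy: "v = pt x y" using point_surj[OF frame] by blast
        have vT: "v \<in> T" using v interior_subset tile_subset[OF t(1)] by blast
        \<comment> \<open>Otherwise the open set \<open>interior t\<close> would meet a strip tile,
          hence also the interior of that tile.\<close>
        have "\<not> y \<le> 1"
        proof
          assume "y \<le> 1"
          then obtain s where s: "s \<in> S" "v \<in> s" using S_cover vT xy by blast
          then have sP: "s \<in> P" "s \<noteq> t" using SP t by auto
          have "v \<in> closure (interior s)" using s triangle_basic(5)[OF tile_triangle[OF sP(1)]] by simp
          then have "interior t \<inter> interior s \<noteq> {}"
            using v open_Int_closure_eq_empty[of "interior t" "interior s"] by blast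
          then show False using disjoint[OF t(1) sP(1)] sP(2) by blast
        qed
        then show "v \<in> T'" using vT xy inT inT' by auto
      qed
      then have "closure (interior t) \<subseteq> T'"
        using triangle_basic(3)[OF T'] by (rule closure_minimal)
      then show ?thesis using triangle_basic(5)[OF tile_triangle[OF t(1)]] by simp
    qed
    have cover': "\<Union>P' = T'"
    proof
      show "\<Union>P' \<subseteq> T'" by (auto simp: P'_def)
      have "interior T' \<subseteq> \<Union>P'"
      proof
        fix v assume v: "v \<in> interior T'"
        obtain x y where xy: "v = pt x y" using point_surj[OF frame] by blast
        have "v \<in> T" using v interior_subset T'T by blast
        then obtain t where t: "t \<in> P" "v \<in> t" using cover by blast
        have "y > 1" using v xy intT' by simp
        then have "t \<notin> S" using S_low t(2) xy by force
        then show "v \<in> \<Union>P'" using t rest by (auto simp: P'_def)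
      qed
      moreover have "closed (\<Union>P')"
        using finite_tiles tile_triangle triangle_basic(3) by (intro closed_Union) (auto simp: P'_def)
      ultimately have "closure (interior T') \<subseteq> \<Union>P'" by (rule closure_minimal)
      then show "T' \<subseteq> \<Union>P'" using triangle_basic(5)[OF T'] by simp
    qed
    have start': "up A' u w 0 0 \<in> P'"
    proof -
      have e: "up A' u w 0 0 = up A u w 0 1" by (simp add: A'_def up_shift)
      have "down A u w 0 0 \<in> P" using strip_down[of 0] m2 by simp
      then have "up A u w 0 1 \<in> P" using next_row_tile by simp
      moreover have "up A u w 0 1 \<subseteq> T'"
      proof
        fix v assume v: "v \<in> up A u w 0 1"
        obtain x y where "v = pt x y" using point_surj[OF frame] by blast
        then show "v \<in> T'" using v mem_up(1)[OF frame] inT' m m2 by auto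
      qed
      ultimately show ?thesis by (simp add: e P'_def)
    qed
    have "corner_tiling a b c T' P' A' u w (k - 1) (k - 1)"
    proof
      show "finite P'" using finite_tiles by (simp add: P'_def)
      show "\<exists>x y z. \<not> collinear {x, y, z} \<and> t = convex hull {x, y, z} \<and>
          {#dist x y, dist z x, dist z y#} = {#a, b, c#}" if "t \<in> P'" for t
        using that tile by (simp add: P'_def)
      show "interior s \<inter> interior t = {}" if "s \<in> P'" "t \<in> P'" "s \<noteq> t" for s t
        using that disjoint by (simp add: P'_def)
      show "\<Union>P' = T'" by (fact cover')
      show "convex T'" using triangle_basic(2)[OF T'] .
      \<comment> \<open>A hanging vertex of the rest is interior to \<open>T'\<close>, so to
        \<open>T\<close>, and hangs there between the same tiles.\<close>
      show "\<not> hanging_vertex T' P' x" for x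
        using no_hanging[of x] interior_mono[OF T'T] unfolding hanging_vertex_def P'_def by blast
    qed (use frame k1 norms order not_right start' in \<open>simp_all add: T'_def\<close>)
    moreover have "card P' < card P"
    proof (rule psubset_card_mono[OF finite_tiles])
      have "pt 0 0 \<in> up A u w 0 0" using mem_up(1)[OF frame] by simp
      then have "up A u w 0 0 \<notin> P'" using inT'[of 0 0] by (auto simp: P'_def)
      then show "P' \<subset> P" using start by (auto simp: P'_def)
    qed
    ultimately have IH: "\<exists>i j::nat. t = up A' u w (real i) (real j) \<or> t = down A' u w (real i) (real j)"
      if "t \<in> P'" for t
      using less.hyps that by blast
    have "\<exists>i j::nat. t = up A u w (real i) (real j) \<or> t = down A u w (real i) (real j)" if "t \<in> P" for t
    proof (cases "t \<in> S")
      case True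
      then obtain i where "t = up A u w (real i) (real 0) \<or> t = down A u w (real i) (real 0)"
        by (auto simp: S_def)
      then show ?thesis by blast
    next
      case False
      then have "t \<in> P'" using rest that by (simp add: P'_def)
      then obtain i j :: nat where "t = up A' u w (real i) (real j) \<or> t = down A' u w (real i) (real j)"
        using IH by blast
      then have "t = up A u w (real i) (real (Suc j)) \<or> t = down A u w (real i) (real (Suc j))"
        by (simp add: A'_def up_shift down_shift)
      then show ?thesis by blast
    qed
    then show ?thesis using m by blast
  qed
qed

section \<open>From a grid of tiles to the trivial reptiling\<close>

lemma not_between_consecutive_ints:
  assumes "real i < of_int n" "of_int n < real i + 1"
  shows False
proof -
  have "of_int (int i) < (of_int n :: real)" "of_int n < (of_int (int i + 1) :: real)"
    using assms by simp_all
  then show False unfolding of_int_less_iff by simp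
qed

text \<open>Within \<open>T\<close> the grid lines are given by integer values of \<open>x\<close>,
  \<open>y\<close> or \<open>x + y\<close>. They avoid the interiors of the tiles and contain the
  boundaries, so the interiors are the components, and taking closures gives back the tiles.\<close>

lemma triangle_grid_trivial:
  fixes m :: nat
  assumes frame: "cross u w \<noteq> 0" and m: "m \<ge> 1"
    and T: "T = convex hull {A, A + real m *\<^sub>R u, A + real m *\<^sub>R w}"
    and tri: "\<And>t. t \<in> P \<Longrightarrow> triangle t"
    and disj: "\<And>s t. s \<in> P \<Longrightarrow> t \<in> P \<Longrightarrow> s \<noteq> t \<Longrightarrow> interior s \<inter> interior t = {}"
    and cover: "\<Union>P = T"
    and grid: "\<And>t. t \<in> P \<Longrightarrow> \<exists>i j::nat. t = up A u w (real i) (real j) \<or> t = down A u w (real i) (real j)"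
  shows "P = trivial_reptiling m T"
proof -
  let ?pt = "point A u w"
  define L where "L = \<Union>(grid_lines m T)"
  have m0: "real m > 0" using m by simp
  have inT: "?pt x y \<in> T \<longleftrightarrow> 0 \<le> x \<and> 0 \<le> y \<and> x + y \<le> real m" for x y
    unfolding T mem_scaled_hull(1)[OF frame m0 m0] using m0 by (simp add: field_simps)
  have "\<not> collinear {A, A + real m *\<^sub>R u, A + real m *\<^sub>R w}"
    by (rule noncollinear_frame) (use frame m0 in simp)
  then have corners: "corners T = {?pt 0 0, ?pt m 0, ?pt 0 m}"
    unfolding T by (simp add: corners_hull point_def)
  have L1: "x \<in> \<int> \<or> y \<in> \<int> \<or> x + y \<in> \<int>" if xy: "?pt x y \<in> L" for x y
  proof -
    obtain l where l: "l \<in> grid_lines m T" "?pt x y \<in> l" using xy L_def by blast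
    obtain p a b s where *: "p \<in> division_points m T" "a \<in> corners T" "b \<in> corners T"
        "?pt x y = p + s *\<^sub>R (b - a)"
      using l unfolding grid_lines_def by blast
    obtain a' b' and i :: nat where p: "a' \<in> corners T" "b' \<in> corners T" "i \<le> m"
        "p = a' + (real i / real m) *\<^sub>R (b' - a')"
      using *(1) unfolding division_points_def by blast
    have lin: "?pt x y + r *\<^sub>R (?pt x' y' - ?pt x'' y'') = ?pt (x + r * (x' - x'')) (y + r * (y' - y''))" for x y r x' y' x'' y''
      by (simp only: point_components) (simp add: algebra_simps)
    \<comment> \<open>Corners have coordinates 0 or \<open>m\<close>, so the denominator
      \<open>m\<close> of a division point cancels.\<close>
    have "\<exists>px py. p = ?pt px py \<and> px \<in> \<int> \<and> py \<in> \<int>"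
      using p m0 unfolding corners by (auto simp: lin point_eq_iff[OF frame])
    then obtain px py where pp: "p = ?pt px py" "px \<in> \<int>" "py \<in> \<int>" by blast
    obtain x1 y1 where a: "a = ?pt x1 y1" "(x1, y1) \<in> {(0,0), (real m,0), (0, real m)}" 
      using *(2) unfolding corners by auto
    obtain x2 y2 where b: "b = ?pt x2 y2" "(x2, y2) \<in> {(0,0), (real m,0), (0, real m)}" 
      using *(3) unfolding corners by auto
    have xs: "x = px + s * (x2 - x1)" and ys: "y = py + s * (y2 - y1)"
      using *(4) unfolding pp a(1) b(1) lin point_eq_iff[OF frame] by auto
    have sum: "x + y = px + py + s * ((x2 - x1) + (y2 - y1))"
      unfolding xs ys by (simp add: algebra_simps)
    \<comment> \<open>A side direction leaves one of \<open>x\<close>, \<open>y\<close>,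
      \<open>x + y\<close> unchanged, so that one keeps the integer value it has at
      \<open>p\<close>.\<close>
    have "x2 - x1 = 0 \<or> y2 - y1 = 0 \<or> (x2 - x1) + (y2 - y1) = 0"
      using a(2) b(2) by auto
    then have "x = px \<or> y = py \<or> x + y = px + py"
      using xs ys sum by (elim disjE) simp_all
    then show ?thesis using pp by auto
  qed
  have L2: "?pt x y \<in> L" if xy: "?pt x y \<in> T" and int: "x \<in> \<nat> \<or> y \<in> \<nat> \<or> x + y \<in> \<nat>" for x y
  proof -
    have line: "?pt x y \<in> L" if "p \<in> division_points m T" "a \<in> corners T" "b \<in> corners T" "a \<noteq> b"
      "?pt x y = p + s *\<^sub>R (b - a)" for p a b s
      unfolding L_def grid_lines_def using that by blast
    have ne: "?pt 0 0 \<noteq> ?pt m 0" "?pt 0 0 \<noteq> ?pt 0 m" "?pt m 0 \<noteq> ?pt 0 m"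
      using m0 by (simp_all add: point_eq_iff[OF frame])
    have d1: "?pt i 0 \<in> division_points m T" if "i \<le> m" for i :: nat
    proof -
      have "?pt i 0 = ?pt 0 0 + (real i / real m) *\<^sub>R (?pt m 0 - ?pt 0 0)"
        using m0 by (simp add: point_def)
      then show ?thesis unfolding division_points_def corners using ne that by blast
    qed
    have d2: "?pt 0 i \<in> division_points m T" if "i \<le> m" for i :: nat
    proof -
      have "?pt 0 i = ?pt 0 0 + (real i / real m) *\<^sub>R (?pt 0 m - ?pt 0 0)"
        using m0 by (simp add: point_def)
      then show ?thesis unfolding division_points_def corners using ne that by blast
    qed
    have b: "0 \<le> x" "0 \<le> y" "x + y \<le> real m" using xy inT by auto
    from int consider (x) i where "x = real i" | (y) i where "y = real i" | (xy) i where "x + y = real i"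
      by (auto elim!: Nats_cases)
    then show ?thesis
    proof cases
      case x
      have "?pt x y = ?pt i 0 + (y / m) *\<^sub>R (?pt 0 m - ?pt 0 0)"
        using m0 x by (simp add: point_def)
      then show ?thesis by (rule line[OF d1, rotated 4]) (use x b ne in \<open>auto simp: corners\<close>)
    next
      case y
      have "?pt x y = ?pt 0 i + (x / m) *\<^sub>R (?pt m 0 - ?pt 0 0)"
        using m0 y by (simp add: point_def)
      then show ?thesis by (rule line[OF d2, rotated 4]) (use y b ne in \<open>auto simp: corners\<close>)
    next
      case xy
      have "?pt x y = ?pt i 0 + (y / m) *\<^sub>R (?pt 0 m - ?pt m 0)"
        using m0 xy[symmetric] by (simp add: point_def algebra_simps)
      then show ?thesis by (rule line[OF d1, rotated 4]) (use xy b ne in \<open>auto simp: corners\<close>)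
    qed
  qed
  have no_int: "z \<notin> \<int>" if "real n < z" "z < real n + 1" for z n
    using that not_between_consecutive_ints by (auto elim!: Ints_cases)
  have int_L: "interior t \<inter> L = {}" if t: "t \<in> P" for t
  proof (rule ccontr)
    assume "interior t \<inter> L \<noteq> {}"
    then obtain v where v: "v \<in> interior t" "v \<in> L" by blast
    obtain x y where xy: "v = ?pt x y" using point_surj[OF frame] by blast
    obtain i j where "t = up A u w (real i) (real j) \<or> t = down A u w (real i) (real j)"
      using grid[OF t] by blast
    then have "real i < x \<and> x < real i + 1 \<and> real j < y \<and> y < real j + 1 \<and>
      (real (i + j) < x + y \<and> x + y < real (i + j) + 1 \<or> real (i + j + 1) < x + y \<and> x + y < real (i + j + 1) + 1)"
      using v(1) xy mem_up(2)[OF frame] mem_down(2)[OF frame] by auto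
    then show False using L1[of x y] v(2) xy no_int by blast
  qed
  have bd_L: "t - interior t \<subseteq> L" if t: "t \<in> P" for t
  proof
    fix v assume v: "v \<in> t - interior t"
    obtain x y where xy: "v = ?pt x y" using point_surj[OF frame] by blast
    obtain i j where "t = up A u w (real i) (real j) \<or> t = down A u w (real i) (real j)"
      using grid[OF t] by blast
    then have "x = real i \<or> y = real j \<or> x + y = real (i + j + 1) \<or> x = real (i + 1) \<or> y = real (j + 1)"
      using v xy mem_up[OF frame] mem_down[OF frame] by auto
    then have "x \<in> \<nat> \<or> y \<in> \<nat> \<or> x + y \<in> \<nat>" using of_nat_in_Nats by metis
    moreover have "v \<in> T" using v t cover by blast
    ultimately show "v \<in> L" using L2 xy by blast
  qed
  have "components (T - L) = interior ` P"
  proof (rule components_open_unique)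
    show "pairwise disjnt (interior ` P)"
      using disj by (auto simp: pairwise_def disjnt_def)
    show "\<Union> (interior ` P) = T - L"
      using int_L bd_L cover interior_subset by fastforce
    show "open X \<and> connected X \<and> X \<noteq> {}" if "X \<in> interior ` P" for X
      using that tri triangle_basic(2,4) by (auto simp: convex_connected convex_interior)
  qed
  then have "trivial_reptiling m T = (\<lambda>t. closure (interior t)) ` P"
    by (simp add: trivial_reptiling_def L_def image_image)
  also have "\<dots> = P"
    using tri triangle_basic(5) by (simp add: image_def)
  finally show ?thesis by simp
qed

section \<open>The tile at the smallest angle\<close>

lemma similarity_segment:
  fixes f :: "'a::euclidean_space \<Rightarrow> 'b::euclidean_space"
  assumes f: "\<And>x y. dist (f x) (f y) = k * dist x y" and k: "k > 0"
  shows "f x \<in> open_segment (f p) (f q) \<longleftrightarrow> x \<in> open_segment p q"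
proof -
  have eq: "f x = f y \<longleftrightarrow> x = y" for x y
    using f[of x y] k by (metis dist_eq_0_iff mult_eq_0_iff less_irrefl)
  have "f x \<in> closed_segment (f p) (f q) \<longleftrightarrow> k * dist p q = k * (dist p x + dist x q)"
    by (simp add: between_mem_segment[symmetric] between f ring_distribs)
  also have "\<dots> \<longleftrightarrow> x \<in> closed_segment p q"
    using k by (simp add: between_mem_segment[symmetric] between)
  finally show ?thesis by (simp add: open_segment_def eq)
qed

text \<open>\<open>f\<close> is only known to scale distances; corners are defined through open
  segments, which distances alone determine.\<close>

lemma similarity_corners:
  fixes f :: "real^2 \<Rightarrow> real^2"
  assumes f: "\<And>x y. dist (f x) (f y) = k * dist x y" and k: "k > 0"
  shows "corners (f ` S) = f ` corners S"
  unfolding corners_def extreme_point_of_def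
  using similarity_segment[of f k, OF f k] by auto

text \<open>The image is given as a triangle, and a triangle is the hull of its corners, so
  transporting corners suffices.\<close>

lemma similar_triangle:
  fixes f :: "real^2 \<Rightarrow> real^2"
  assumes f: "\<And>x y. dist (f x) (f y) = k * dist x y" and k: "k > 0"
    and nc: "\<not> collinear {p, q, r}" and t: "f ` (convex hull {p, q, r}) = t" "triangle t"
  shows "\<not> collinear {f p, f q, f r} \<and> t = convex hull {f p, f q, f r}"
proof -
  obtain x y z where *: "\<not> collinear {x, y, z}" "t = convex hull {x, y, z}"
    using t(2) triangle_iff by blast
  have "{x, y, z} = corners t" unfolding *(2) by (rule corners_hull[OF *(1), symmetric])
  also have "\<dots> = f ` corners (convex hull {p, q, r})"
    unfolding t(1)[symmetric] by (rule similarity_corners[OF f k])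
  also have "\<dots> = {f p, f q, f r}" unfolding corners_hull[OF nc] by blast
  finally show ?thesis using * by metis
qed

lemma sorted_triangle:
  assumes "triangle T"
  obtains A B C where "\<not> collinear {A, B, C}" "T = convex hull {A, B, C}"
    "dist B C \<le> dist A C" "dist A C \<le> dist A B"
proof -
  obtain p q r where *: "\<not> collinear {p, q, r}" "T = convex hull {p, q, r}"
    using assms triangle_iff by blast
  note result = that
  have perm: thesis if "dist y z \<le> dist x z" "dist x z \<le> dist x y" and eq: "{x, y, z} = {p, q, r}" for x y z
  proof -
    have "\<not> collinear {x, y, z}" "T = convex hull {x, y, z}" unfolding eq by (fact *)+
    then show thesis using that(1,2) by (rule result)
  qed
  consider "dist q r \<le> dist p r" "dist p r \<le> dist p q" | "dist q r \<le> dist p q" "dist p q \<le> dist p r"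
    | "dist p r \<le> dist q r" "dist q r \<le> dist p q" | "dist p r \<le> dist p q" "dist p q \<le> dist q r"
    | "dist p q \<le> dist q r" "dist q r \<le> dist p r" | "dist p q \<le> dist p r" "dist p r \<le> dist q r"
    by linarith
  then show thesis
  proof cases
    case 1
    then show ?thesis by (intro perm[of q r p]) (auto simp: dist_commute)
  next
    case 2
    then show ?thesis by (intro perm[of r q p]) (auto simp: dist_commute)
  next
    case 3
    then show ?thesis by (intro perm[of p r q]) (auto simp: dist_commute)
  next
    case 4
    then show ?thesis by (intro perm[of r p q]) (auto simp: dist_commute)
  next
    case 5
    then show ?thesis by (intro perm[of p q r]) (auto simp: dist_commute)
  next
    case 6
    then show ?thesis by (intro perm[of q p r]) (auto simp: dist_commute)
  qed
qed

lemma inner_via_norms: "x \<bullet> y = ((norm x)\<^sup>2 + (norm y)\<^sup>2 - (norm (y - x))\<^sup>2) / 2"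
  for x y :: "'a::real_inner"
  by (simp add: power2_norm_eq_inner inner_diff_left inner_diff_right inner_commute)

text \<open>Heron's formula, both sides being 16 times the squared area of the triangle with corners
  \<open>0\<close>, \<open>x\<close>, \<open>y\<close>.\<close>

lemma cross_heron:
  "4 * (cross x y)\<^sup>2 = ((norm x)\<^sup>2 + (norm y)\<^sup>2 + (norm (y - x))\<^sup>2)\<^sup>2
    - 2 * (((norm x)\<^sup>2)\<^sup>2 + ((norm y)\<^sup>2)\<^sup>2 + ((norm (y - x))\<^sup>2)\<^sup>2)"
proof -
  define X Y Z where "X = (norm x)\<^sup>2" "Y = (norm y)\<^sup>2" "Z = (norm (y - x))\<^sup>2"
  have "(cross x y)\<^sup>2 = X * Y - ((X + Y - Z) / 2)\<^sup>2"
    using cross_lagrange[of x y] inner_via_norms[of x y]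
    by (simp add: X_Y_Z_def power2_norm_eq_inner)
  then show ?thesis
    unfolding X_Y_Z_def[symmetric] by (simp add: power2_eq_square field_simps)
qed

text \<open>The idea is to compare cotangents: \<open>inner / cross\<close> is monotone in the angle, and no angle
  of a tile is smaller than the angle of \<open>T\<close> at \<open>A\<close>.\<close>

lemma (in edge_to_edge_tiling) tile_at_smallest_corner:
  assumes frame: "cross U W \<noteq> 0" and T: "T = convex hull {A, A + U, A + W}"
    and s: "s > 0" "norm U = s * b" "norm W = s * c" "norm (W - U) = s * a"
    and order: "a \<le> b" "b \<le> c"
  obtains x y where "x > 0" "y > 0" "convex hull {A, A + x *\<^sub>R U, A + y *\<^sub>R W} \<in> P"
    "norm (y *\<^sub>R W - x *\<^sub>R U) = a"
    "norm (x *\<^sub>R U) = b \<and> norm (y *\<^sub>R W) = c \<or> norm (x *\<^sub>R U) = c \<and> norm (y *\<^sub>R W) = b"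
proof -
  have "W \<noteq> U" using frame by auto
  then have "0 < s * a" using s(4) by (metis norm_eq_zero eq_iff_diff_eq_0 norm_ge_zero less_eq_real_def)
  then have a0: "a > 0" using s(1) by (simp add: zero_less_mult_iff)
  have A: "A \<in> corners T" unfolding T corners_hull[OF noncollinear_frame[OF frame]] by simp
  then have "A \<in> T" by (simp add: corners_def extreme_point_of_def)
  then obtain t where t: "t \<in> P" "A \<in> t" using cover by blast
  obtain x y z where xyz: "\<not> collinear {x, y, z}" "t = convex hull {x, y, z}"
    using tile_triangle[OF t(1)] triangle_iff by blast
  have "A \<in> corners t"
    using A t(2) tile_subset[OF t(1)] by (auto simp: corners_def extreme_point_of_def)
  then have "A = x \<or> A = y \<or> A = z" unfolding xyz(2) corners_hull[OF xyz(1)] by simp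
  moreover have "{y, x, z} = {x, y, z}" "{z, x, y} = {x, y, z}" by blast+
  ultimately obtain p q where pq: "\<not> collinear {A, p, q}" "t = convex hull {A, p, q}"
    using xyz by metis
  \<comment> \<open>Swapping \<open>p\<close> and \<open>q\<close> if necessary gives the tile the
    orientation of the frame.\<close>
  obtain p q where pq: "t = convex hull {A, p, q}" and pos: "cross (p - A) (q - A) / cross U W > 0"
  proof -
    have n: "cross (p - A) (q - A) \<noteq> 0" using pq(1) collinear_iff_cross by simp
    then have "cross (p - A) (q - A) / cross U W \<noteq> 0" using frame by simp
    moreover have "cross (q - A) (p - A) / cross U W = - (cross (p - A) (q - A) / cross U W)"
      unfolding cross_commute[of "q - A"] by (rule minus_divide_left[symmetric])
    ultimately have "cross (p - A) (q - A) / cross U W > 0 \<or> cross (q - A) (p - A) / cross U W > 0"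
      by linarith
    moreover have "{A, q, p} = {A, p, q}" by blast
    ultimately show thesis using that pq(2) by metis
  qed
  have nc: "\<not> collinear {A, p, q}" using pos collinear_iff_cross by auto
  have sides: "{#dist A p, dist q A, dist q p#} = {#a, b, c#}"
    by (rule tile_sides[OF t(1)[unfolded pq] nc])
  obtain p1 p2 where p: "p = point A U W p1 p2" using point_surj[OF frame] .
  obtain q1 q2 where q: "q = point A U W q1 q2" using point_surj[OF frame] .
  have "p \<in> T" "q \<in> T" using tile_subset[OF t(1)] pq by (auto simp: hull_inc)
  then have nn: "0 \<le> p1" "0 \<le> p2" "0 \<le> q1" "0 \<le> q2"
    unfolding T p q mem_frame_hull[OF frame] by auto
  \<comment> \<open>The ratio of the area of the tile to that of \<open>T\<close>; Heron's formula
    identifies it as \<open>1 / s\<^sup>2\<close>.\<close>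
  define \<delta> where "\<delta> = p1 * q2 - p2 * q1"
  have pA: "p - A = p1 *\<^sub>R U + p2 *\<^sub>R W" "q - A = q1 *\<^sub>R U + q2 *\<^sub>R W" by (simp_all add: p q point_def)
  have cr: "cross (p - A) (q - A) = \<delta> * cross U W"
    unfolding pA using cross_commute[of W U] by (simp add: \<delta>_def algebra_simps)
  then have \<delta>0: "\<delta> > 0" using pos frame by simp
  define H where "H = (a\<^sup>2 + b\<^sup>2 + c\<^sup>2)\<^sup>2 - 2 * ((a\<^sup>2)\<^sup>2 + (b\<^sup>2)\<^sup>2 + (c\<^sup>2)\<^sup>2)"
  have HU: "4 * (cross U W)\<^sup>2 = s ^ 4 * H"
    unfolding cross_heron s by (simp add: H_def power2_eq_square power4_eq_xxxx algebra_simps)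
  have norms: "norm (p - A) = dist A p" "norm (q - A) = dist q A" "norm (q - A - (p - A)) = dist q p"
    by (simp_all add: dist_norm norm_minus_commute)
  have Hp: "4 * (cross (p - A) (q - A))\<^sup>2 = H"
  proof -
    \<comment> \<open>A function of the multiset, so that \<open>sides\<close> applies without
      knowing which side is which.\<close>
    define F where "F M = (\<Sum>x\<in>#M. x\<^sup>2)\<^sup>2 - 2 * (\<Sum>x\<in>#M. (x\<^sup>2)\<^sup>2)" for M :: "real multiset"
    have "4 * (cross (p - A) (q - A))\<^sup>2 = F {#dist A p, dist q A, dist q p#}"
      unfolding cross_heron norms F_def by (simp add: algebra_simps)
    also have "\<dots> = F {#a, b, c#}" unfolding sides ..
    also have "\<dots> = H" by (simp add: F_def H_def algebra_simps)
    finally show ?thesis .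
  qed
  have "H \<noteq> 0" using HU frame by auto
  moreover have "H = (\<delta> * s\<^sup>2)\<^sup>2 * H"
  proof -
    have "H = \<delta>\<^sup>2 * (4 * (cross U W)\<^sup>2)" using Hp cr by (simp add: power_mult_distrib)
    also have "\<dots> = (\<delta> * s\<^sup>2)\<^sup>2 * H" unfolding HU by (simp add: power_mult_distrib)
    finally show ?thesis .
  qed
  ultimately have "(\<delta> * s\<^sup>2)\<^sup>2 = 1" by simp
  then have \<delta>s: "\<delta> * s\<^sup>2 = 1" using \<delta>0 s(1) by (simp add: power2_eq_1_iff)
      (smt (verit) mult_nonneg_nonneg zero_le_power2)
  have I: "U \<bullet> W = s\<^sup>2 * ((b\<^sup>2 + c\<^sup>2 - a\<^sup>2) / 2)"
    unfolding inner_via_norms[of U W] s by (simp add: power_mult_distrib algebra_simps)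
  have ab2: "a\<^sup>2 \<le> b\<^sup>2" "b\<^sup>2 \<le> c\<^sup>2" using order a0 by (auto intro!: power_mono)
  have a2: "0 < a\<^sup>2" using a0 by simp
  have "b\<^sup>2 + c\<^sup>2 - a\<^sup>2 > 0" using ab2 a2 by linarith
  then have I0: "U \<bullet> W > 0" unfolding I using s(1) by simp
  have sq: "(dist A p)\<^sup>2 + (dist q A)\<^sup>2 + (dist q p)\<^sup>2 = a\<^sup>2 + b\<^sup>2 + c\<^sup>2"
  proof -
    have "(\<Sum>x\<in>#{#dist A p, dist q A, dist q p#}. x\<^sup>2) = (\<Sum>x\<in>#{#a, b, c#}. x\<^sup>2)" unfolding sides ..
    then show ?thesis by simp
  qed
  have ip: "(p - A) \<bullet> (q - A) = (a\<^sup>2 + b\<^sup>2 + c\<^sup>2) / 2 - (dist q p)\<^sup>2"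
    unfolding inner_via_norms[of "p - A"] norms using sq by (simp add: field_simps)
  have "dist q p \<in># {#a, b, c#}" unfolding sides[symmetric] by simp
  then have "a \<le> dist q p" using order by auto
  then have qp: "a\<^sup>2 \<le> (dist q p)\<^sup>2" using a0 by (intro power_mono) auto
  have dI: "\<delta> * (U \<bullet> W) = (b\<^sup>2 + c\<^sup>2 - a\<^sup>2) / 2"
    unfolding I using \<delta>s by (simp only: mult.assoc[symmetric])
  have "(p - A) \<bullet> (q - A) = p1 * q1 * (U \<bullet> U) + p2 * q2 * (W \<bullet> W) + (p1 * q2 + p2 * q1) * (U \<bullet> W)"
    unfolding pA by (simp add: inner_add_left inner_add_right inner_commute algebra_simps)
  \<comment> \<open>Scaled by \<open>\<delta>\<close>, the determinant of the frame equals that of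
    the tile, so comparing cotangents means subtracting inner products. What remains is a zero sum
    of nonnegative terms, \<open>U \<bullet> W\<close> being positive because the smallest angle is
    acute; it forces \<open>p\<close> and \<open>q\<close> onto the sides of
    \<open>T\<close>.\<close>
  then have key: "p1 * q1 * (U \<bullet> U) + p2 * q2 * (W \<bullet> W) + 2 * (p2 * q1) * (U \<bullet> W) + ((dist q p)\<^sup>2 - a\<^sup>2) = 0"
    using ip dI unfolding \<delta>_def by (simp add: algebra_simps)
  have UW: "U \<bullet> U > 0" "W \<bullet> W > 0" using frame by auto
  have terms: "0 \<le> p1 * q1 * (U \<bullet> U)" "0 \<le> p2 * q2 * (W \<bullet> W)" "0 \<le> 2 * (p2 * q1) * (U \<bullet> W)"
    using nn UW I0 by simp_all
  have z: "p1 * q1 * (U \<bullet> U) = 0" "p2 * q2 * (W \<bullet> W) = 0" and eqa: "(dist q p)\<^sup>2 = a\<^sup>2"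
    using key terms qp by linarith+
  have "0 < p1 * q2" using \<delta>0 nn unfolding \<delta>_def by (smt (verit) mult_nonneg_nonneg)
  then have pq0: "p1 > 0" "q2 > 0" using nn by (auto simp: zero_less_mult_iff)
  have "q1 = 0" "p2 = 0" using z UW pq0 by auto
  then have pe: "p - A = p1 *\<^sub>R U" "q - A = q2 *\<^sub>R W" "p = A + p1 *\<^sub>R U" "q = A + q2 *\<^sub>R W"
    using pA by (simp_all add: p q point_def)
  have da: "dist q p = a" using eqa a0 by (simp add: power2_eq_iff_nonneg)
  have "add_mset a {#dist A p, dist q A#} = add_mset a {#b, c#}"
    using sides unfolding da by (simp only: add_mset_commute)
  then have "{#dist A p, dist q A#} = {#b, c#}" by (simp only: add_mset_add_mset_same_iff)
  then have "dist A p = b \<and> dist q A = c \<or> dist A p = c \<and> dist q A = b"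
    by (auto simp: add_eq_conv_ex)
  then have "norm (p1 *\<^sub>R U) = b \<and> norm (q2 *\<^sub>R W) = c \<or> norm (p1 *\<^sub>R U) = c \<and> norm (q2 *\<^sub>R W) = b"
    using norms(1,2) pe(1,2) by metis
  moreover have "norm (q2 *\<^sub>R W - p1 *\<^sub>R U) = a" using norms(3) da pe(1,2) by metis
  moreover have "convex hull {A, A + p1 *\<^sub>R U, A + q2 *\<^sub>R W} \<in> P" using t(1) pq pe(3,4) by simp
  ultimately show thesis using that pq0 by blast
qed

text \<open>A corner tile lying the same way round as \<open>T\<close> gives the frame at once. For
  a reversed one, the strip runs along the longest side of \<open>T\<close>, and its last apex lies
  in \<open>T\<close> only if \<open>x \<le> y\<close>. This forces \<open>b = c\<close>, and then
  the reversed frame is admissible as well.\<close>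

lemma (in edge_to_edge_tiling) scaled_corner_tiling:
  assumes frame: "cross U W \<noteq> 0" and T: "T = convex hull {A, A + U, A + W}"
    and s: "s > 0" "norm U = s * b" "norm W = s * c" "norm (W - U) = s * a"
    and order: "a \<le> b" "b \<le> c" and nr: "a\<^sup>2 + b\<^sup>2 \<noteq> c\<^sup>2"
  obtains u w where "corner_tiling a b c T P A u w s s"
proof -
  obtain x y where xy: "x > 0" "y > 0" "convex hull {A, A + x *\<^sub>R U, A + y *\<^sub>R W} \<in> P"
    "norm (y *\<^sub>R W - x *\<^sub>R U) = a"
    "norm (x *\<^sub>R U) = b \<and> norm (y *\<^sub>R W) = c \<or> norm (x *\<^sub>R U) = c \<and> norm (y *\<^sub>R W) = b"
    using tile_at_smallest_corner[OF frame T s order] .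
  have U0: "norm U > 0" "norm W > 0" using frame by auto
  have bc: "b > 0" "c > 0" using U0 s by (auto simp: zero_less_mult_iff)
  have fr: "cross (x *\<^sub>R U) (y *\<^sub>R W) \<noteq> 0" "cross (y *\<^sub>R W) (x *\<^sub>R U) \<noteq> 0"
    using frame cross_commute[of W U] xy by auto
  have T1: "T = convex hull {A, A + (1 / x) *\<^sub>R (x *\<^sub>R U), A + (1 / y) *\<^sub>R (y *\<^sub>R W)}"
    using T xy by simp
  have T2: "T = convex hull {A, A + (1 / y) *\<^sub>R (y *\<^sub>R W), A + (1 / x) *\<^sub>R (x *\<^sub>R U)}"
    using T1 by (simp add: insert_commute)
  have st1: "up A (x *\<^sub>R U) (y *\<^sub>R W) 0 0 \<in> P" using xy(3) by (simp add: up_def point_def)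
  have st2: "up A (y *\<^sub>R W) (x *\<^sub>R U) 0 0 \<in> P" using xy(3) by (simp add: up_def point_def insert_commute)
  consider "norm (x *\<^sub>R U) = b" "norm (y *\<^sub>R W) = c" | "norm (x *\<^sub>R U) = c" "norm (y *\<^sub>R W) = b"
    using xy(5) by blast
  then show thesis
  proof cases
    case 1
    have "x * s = 1" "y * s = 1" using 1 s xy bc by simp_all
    then have "1 / x = s" "1 / y = s" using xy by (simp_all add: field_simps)
    then have "T = convex hull {A, A + s *\<^sub>R x *\<^sub>R U, A + s *\<^sub>R y *\<^sub>R W}" using T1 by simp
    then have "corner_tiling a b c T P A (x *\<^sub>R U) (y *\<^sub>R W) s s"
      by (intro corner_tiling.intro corner_tiling_axioms.intro edge_to_edge_tiling_axioms
          fr s(1) 1 xy(4) order nr st1)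
    then show thesis by (rule that)
  next
    case 2
    have inv: "1 / y > 0" "1 / x > 0" using xy(1,2) by simp_all
    have na: "norm (x *\<^sub>R U - y *\<^sub>R W) = a" using xy(4) by (simp add: norm_minus_commute)
    interpret corner_tiling a b c T P A "y *\<^sub>R W" "x *\<^sub>R U" "1 / y" "1 / x"
      by (intro corner_tiling.intro corner_tiling_axioms.intro edge_to_edge_tiling_axioms
          inv fr T2 2 na order nr st2)
    obtain m :: nat where m: "m \<ge> 1" "1 / y = real m" and ups: "\<And>i. i < m \<Longrightarrow> up A (y *\<^sub>R W) (x *\<^sub>R U) (real i) 0 \<in> P"
      by (rule strip) (rule that)
    have "up A (y *\<^sub>R W) (x *\<^sub>R U) (real (m - 1)) 0 \<subseteq> T" using tile_subset ups[of "m - 1"] m by simp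
    moreover have "point A (y *\<^sub>R W) (x *\<^sub>R U) (real (m - 1)) 1 \<in> up A (y *\<^sub>R W) (x *\<^sub>R U) (real (m - 1)) 0"
      using mem_up(1)[OF fr(2)] by simp
    \<comment> \<open>With \<open>1 / y = m\<close> the left-hand side equals
      \<open>1 - y + x\<close>.\<close>
    ultimately have "real (m - 1) / (1 / y) + 1 / (1 / x) \<le> 1" using mem_T(1) by blast
    moreover have "real (m - 1) = 1 / y - 1" using m by (simp add: of_nat_diff)
    ultimately have "x \<le> y" using xy by (simp add: field_simps)
    moreover have xs: "x * (s * b) = c" "y * (s * c) = b" using 2 s xy by simp_all
    have "b = c"
    proof (rule antisym)
      have "c * c = (x * s) * (b * c)" using xs(1) by (simp add: algebra_simps)
      also have "\<dots> \<le> (y * s) * (b * c)" using \<open>x \<le> y\<close> s(1) bc by (intro mult_right_mono) auto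
      also have "\<dots> = b * b" using xs(2) by (simp add: algebra_simps)
      finally have "c\<^sup>2 \<le> b\<^sup>2" by (simp add: power2_eq_square)
      then show "c \<le> b" using bc by (simp add: power2_le_iff_abs_le)
    qed (fact order)
    then have "x * s = 1" "y * s = 1" using xs bc by simp_all
    then have "1 / x = s" "1 / y = s" using xy by (simp_all add: field_simps)
    then have "corner_tiling a b c T P A (y *\<^sub>R W) (x *\<^sub>R U) s s"
      using corner_tiling_axioms by simp
    then show thesis by (rule that)
  qed
qed

theorem theorem6:
  fixes T :: "(real^2) set" and P :: "(real^2) set set" and r :: nat
  assumes "oblique_triangle T"
    and "nontrivial_reptiling r T P"
  shows "\<exists>x. hanging_vertex T P x"
proof (rule ccontr)
  assume no: "\<not> ?thesis"
  have rep: "reptiling r T P" and nontriv: "\<not> (\<exists>n\<ge>1. P = trivial_reptiling n T)"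
    using assms(2) by (auto simp: nontrivial_reptiling_def)
  have T_tri: "triangle T" and not_right: "\<not> right_triangle T"
    using assms(1) by (auto simp: oblique_triangle_def)
  have fin: "finite P" and card: "card P \<ge> 2" and tri: "\<And>t. t \<in> P \<Longrightarrow> triangle t"
    and sim: "\<And>t. t \<in> P \<Longrightarrow> similar_sets T t"
    and cong: "\<And>s t. s \<in> P \<Longrightarrow> t \<in> P \<Longrightarrow> congruent_sets s t"
    and disj: "\<And>s t. s \<in> P \<Longrightarrow> t \<in> P \<Longrightarrow> s \<noteq> t \<Longrightarrow> interior s \<inter> interior t = {}"
    and cover: "\<Union>P = T"
    using rep by (auto simp: reptiling_def pairwise_def)
  obtain A B C where ABC: "\<not> collinear {A, B, C}" "T = convex hull {A, B, C}"
    "dist B C \<le> dist A C" "dist A C \<le> dist A B"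
    using sorted_triangle[OF T_tri] .
  have "P \<noteq> {}" using card by auto
  then obtain t0 where t0: "t0 \<in> P" by blast
  obtain f \<kappa> where f: "\<kappa> > 0" "\<And>x y. dist (f x) (f y) = \<kappa> * dist x y" "f ` T = t0"
    using sim[OF t0] unfolding similar_sets_def by blast
  define a b c where "a = \<kappa> * dist B C" "b = \<kappa> * dist A C" "c = \<kappa> * dist A B"
  have tile: "\<exists>x y z. \<not> collinear {x, y, z} \<and> t = convex hull {x, y, z} \<and>
      {#dist x y, dist z x, dist z y#} = {#a, b, c#}" if t: "t \<in> P" for t
  proof -
    obtain g where g: "\<And>x y. dist (g x) (g y) = dist x y" "g ` t0 = t"
      using cong[OF t0 t] unfolding congruent_sets_def by blast
    define h where "h = g \<circ> f"
    have h: "dist (h x) (h y) = \<kappa> * dist x y" for x y by (simp add: h_def g f)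
    have hT: "h ` (convex hull {A, B, C}) = t"
      using g(2) f(3) unfolding ABC(2)[symmetric] h_def image_comp[symmetric] by simp
    have "\<not> collinear {h C, h B, h A} \<and> t = convex hull {h C, h B, h A}"
    proof -
      have "{h C, h B, h A} = {h A, h B, h C}" by blast
      then show ?thesis using similar_triangle[OF h f(1) ABC(1) hT tri[OF t]] by metis
    qed
    moreover have "{#dist (h C) (h B), dist (h A) (h C), dist (h A) (h B)#} = {#a, b, c#}"
      unfolding h a_b_c_def by (simp only: dist_commute)
    ultimately show ?thesis by blast
  qed
  interpret edge_to_edge_tiling a b c T P
    by unfold_locales (use fin tile disj cover no triangle_basic(2)[OF T_tri] in auto)
  define U W where "U = C - A" "W = B - A"
  have frame: "cross U W \<noteq> 0" 
    using ABC(1) cross_commute[of U W] by (simp add: collinear_iff_cross U_W_def)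
  have T_UW: "T = convex hull {A, A + U, A + W}" using ABC(2) by (simp add: U_W_def insert_commute)
  have s: "1 / \<kappa> > 0" "norm U = 1 / \<kappa> * b" "norm W = 1 / \<kappa> * c" "norm (W - U) = 1 / \<kappa> * a"
    using f(1) by (simp_all add: a_b_c_def U_W_def dist_norm norm_minus_commute)
  have order: "a \<le> b" "b \<le> c" using ABC(3,4) f(1) by (simp_all add: a_b_c_def)
  \<comment> \<open>The side \<open>c\<close> corresponds to the side of \<open>T\<close> opposite
    \<open>C\<close>, so equality would make the angle at \<open>C\<close> right.\<close>
  have "a\<^sup>2 + b\<^sup>2 \<noteq> c\<^sup>2"
  proof
    assume "a\<^sup>2 + b\<^sup>2 = c\<^sup>2"
    then have "\<kappa>\<^sup>2 * ((dist B C)\<^sup>2 + (dist A C)\<^sup>2 - (dist A B)\<^sup>2) = 0"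
      by (simp add: a_b_c_def power_mult_distrib algebra_simps)
    then have "(dist A C)\<^sup>2 + (dist B C)\<^sup>2 - (dist A B)\<^sup>2 = 0" using f(1) by simp
    then have "(A - C) \<bullet> (B - C) = 0"
      unfolding inner_via_norms[of "A - C"] by (simp add: dist_norm norm_minus_commute[of B A])
    moreover have "corners T = {C, A, B}"
      unfolding ABC(2) corners_hull[OF ABC(1)] by blast
    ultimately have "right_triangle T"
      using T_tri unfolding right_triangle_def orthogonal_def by blast
    then show False using not_right by simp
  qed
  then obtain u w where ct: "corner_tiling a b c T P A u w (1 / \<kappa>) (1 / \<kappa>)"
    using scaled_corner_tiling[OF frame T_UW s order] by blast
  obtain m :: nat where m: "m \<ge> 1" "1 / \<kappa> = real m"
    "\<And>t. t \<in> P \<Longrightarrow> \<exists>i j::nat. t = up A u w (real i) (real j) \<or> t = down A u w (real i) (real j)"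
    using grid_tiles[OF ct] by blast
  have "P = trivial_reptiling m T"
    by (rule triangle_grid_trivial[OF corner_tiling.frame[OF ct] m(1) _ tri disj cover m(3)])
      (use corner_tiling.T_eq[OF ct] m(2) in auto)
  then show False using nontriv m(1) by blast
qed

end
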